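(* Let $n\ge 3$, let $J\subseteq\{1,\dots,n\}$ be nonempty, let $r_k>0$ for $k\in J$, let $\mathcal X(J)=\bigcup_{k\in J}\frac{r_k}{\sqrt k}\,\mathcal I^n_k$ with norm spectrum $R=\{r_k: k\in J\}$, and consider positive weight functions $w$ on $\mathcal X(J)$ taking a constant value $w_k$ on each $\frac{r_k}{\sqrt k}\mathcal I^n_k$. Then: 1. For all choices of $J$, $R$ (i.e. of the $r_k$) and $w$, the strength of $(\mathcal X(J),w)$ is $3$, $5$, or $7$. 2. Suppose $|R|=1$. (a) If $J=\{k\}$, then there is a weight function $w$ for which $(\mathcal X(J),w)$ is a Euclidean $5$-design if and only if $n\equiv 1 \pmod 3$ and $k=\frac{n+2}{3}$. (b) If $|J|=1$, then $(\mathcal X(J),w)$ is never a Euclidean $7$-design. (c) If $J=\{k_1,k_2\}$ with $k_1<k_2$, then there is a weight function $w$ for which $(\mathcal X(J),w)$ is a Euclidean $5$-design if and only if $k_1<\frac{n+2}{3}<k_2$. (d) If $J=\{k_1,k_2\}$, then there is a weight function $w$ for which $(\mathcal X(J),w)$ is a Euclidean $7$-design if and only if $G(k_1,k_2)=0$. (e) If $J=\{k_1,k_2,k_3\}$ with $k_1<k_2<k_3$, then there is a weight function $w$ for which $(\mathcal X(J),w)$ is a Euclidean $7$-design if and only if $G(k_1,k_2)>0$, $G(k_2,k_3)>0$ and $G(k_1,k_3)<0$. 3. Suppose $|R|=2$. (a) If $J=\{k_1,k_2\}$ with $k_1<k_2$, then there is a weight function $w$ for which $(\mathcal X(J),w)$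 is a Euclidean $5$-design if and only if $k_1<\frac{n+2}{3}<k_2$. (b) If $|J|=2$, then $(\mathcal X(J),w)$ is never a Euclidean $7$-design. (c) If $J=\{k_1,k_2,k_3\}$ with $k_1<k_2<k_3$, then there is a weight function $w$ for which $(\mathcal X(J),w)$ is a Euclidean $7$-design if and only if $n\equiv 1\pmod 3$, $k_2=\frac{n+2}{3}$, $r_{k_1}=r_{k_3}$, and $G(k_1,k_3)<0$. 4. Suppose $|R|=3$ and $J=\{k_1,k_2,k_3\}$ with $k_1<k_2<k_3$. Then there is a weight function $w$ for which $(\mathcal X(J),w)$ is a Euclidean $7$-design if and only if $G(k_1,k_2)>0$, $G(k_2,k_3)>0$, $G(k_1,k_3)<0$, and $$\sum_{i=1}^{3} k_i\,(n+2-3k_i)\,(k_{i+1}-k_{i+2})\,G(k_{i+1},k_{i+2})\,\frac{1}{r_{k_i}^2}=0,$$ where indices are taken mod 3 (so $k_4=k_1$, $k_5=k_2$).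
   Context: For a finite set $\mathcal X\subset\mathbb R^n\setminus\{0\}$ with a positive weight function $w:\mathcal X\to\mathbb R^+$, the norm spectrum is $R=\{\|x\|:x\in\mathcal X\}$, the layers are $\mathcal X_r=\mathcal X\cap S^{n-1}_r$ ($S^{n-1}_r$ the sphere of radius $r$ centered at the origin), and $W_r=\sum_{x\in\mathcal X_r}w(x)$. $(\mathcal X,w)$ is a Euclidean $t$-design if $\sum_{r\in R}W_r\,\overline f_{S^{n-1}_r}=\sum_{x\in\mathcal X}w(x)f(x)$ for every real polynomial $f$ in $n$ variables of total degree at most $t$, where $\overline f_{S^{n-1}_r}$ is the average of $f$ over $S^{n-1}_r$ with respect to surface measure. The strength of $(\mathcal X,w)$ is the largest $t$ for which it is a Euclidean $t$-design. For $1\le k\le n$, $\mathcal I^n_k$ is the orbit of $e_1+\dots+e_k$ under the hyperoctahedral group (generated by coordinate permutations and coordinate sign changes), i.e. the set of vectors in $\{-1,0,1\}^n$ with exactly $k$ nonzero entries. Different $k\in J$ may have equal $r_k$. For positive integers $k_1,k_2\le n$, $G(k_1,k_2)=(n+2-3k_1)(n+2-3k_2)+6(k_1-1)(k_2-1)+2(n-1)$. *)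

theory Defs
  imports "HOL-Analysis.Analysis"
begin

definition poly_deg_le :: "nat \<Rightarrow> (real^'n \<Rightarrow> real) \<Rightarrow> bool" where
  "poly_deg_le t f \<longleftrightarrow>
     (\<exists>(A :: ('n \<Rightarrow> nat) set) (c :: ('n \<Rightarrow> nat) \<Rightarrow> real).
        finite A \<and> (\<forall>\<alpha>\<in>A. (\<Sum>i\<in>UNIV. \<alpha> i) \<le> t) \<and>
        f = (\<lambda>x. \<Sum>\<alpha>\<in>A. c \<alpha> * (\<Prod>i\<in>UNIV. (x $ i) ^ (\<alpha> i))))"

text \<open>Average of f over the sphere of radius r centred at 0 with respect to
  (normalised) surface measure.  The normalised surface measure on the sphere
  coincides with the cone measure: sigma(A) = vol({t a | a in A, 0 <= t <= 1}) / vol(ball),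
  which gives the formula below.\<close>
definition sphere_avg :: "(real^'n \<Rightarrow> real) \<Rightarrow> real \<Rightarrow> real" where
  "sphere_avg f r =
     integral (ball 0 1) (\<lambda>x. f (r *\<^sub>R (x /\<^sub>R norm x))) / measure lebesgue (ball (0::real^'n) 1)"

definition layer_weight :: "(real^'n) set \<Rightarrow> (real^'n \<Rightarrow> real) \<Rightarrow> real \<Rightarrow> real" where
  "layer_weight X w r = (\<Sum>x\<in>X \<inter> sphere 0 r. w x)"

definition euclidean_design :: "(real^'n) set \<Rightarrow> (real^'n \<Rightarrow> real) \<Rightarrow> nat \<Rightarrow> bool" where
  "euclidean_design X w t \<longleftrightarrow>
     (\<forall>f. poly_deg_le t f \<longrightarrow>
        (\<Sum>r\<in>norm ` X. layer_weight X w r * sphere_avg f r) = (\<Sum>x\<in>X. w x * f x))"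

definition design_strength :: "(real^'n) set \<Rightarrow> (real^'n \<Rightarrow> real) \<Rightarrow> nat" where
  "design_strength X w = (GREATEST t. euclidean_design X w t)"

text \<open>Orbit I^n_k of e_1+...+e_k under the hyperoctahedral group.\<close>
definition Ink :: "nat \<Rightarrow> (real^'n) set" where
  "Ink k = {x. (\<forall>i. x $ i \<in> {-1, 0, 1}) \<and> card {i. x $ i \<noteq> 0} = k}"

definition XJ :: "nat set \<Rightarrow> (nat \<Rightarrow> real) \<Rightarrow> (real^'n) set" where
  "XJ J r = (\<Union>k\<in>J. (\<lambda>x. (r k / sqrt (real k)) *\<^sub>R x) ` Ink k)"

text \<open>Weight function constant (value wk k) on each shell (r_k/sqrt k) I^n_k;
  the shell of a point is determined by its number of nonzero coordinates.\<close>
definition layer_wfun :: "(nat \<Rightarrow> real) \<Rightarrow> real^'n \<Rightarrow> real" where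
  "layer_wfun wk x = wk (card {i. x $ i \<noteq> 0})"

definition Gfun :: "nat \<Rightarrow> nat \<Rightarrow> nat \<Rightarrow> int" where
  "Gfun n k1 k2 = (int n + 2 - 3 * int k1) * (int n + 2 - 3 * int k2)
                  + 6 * (int k1 - 1) * (int k2 - 1) + 2 * (int n - 1)"

definition admissible :: "nat \<Rightarrow> nat set \<Rightarrow> (nat \<Rightarrow> real) \<Rightarrow> bool" where
  "admissible n J r \<longleftrightarrow> J \<subseteq> {1..n} \<and> J \<noteq> {} \<and> (\<forall>k\<in>J. r k > 0)"

definition pos_weights :: "nat set \<Rightarrow> (nat \<Rightarrow> real) \<Rightarrow> bool" where
  "pos_weights J wk \<longleftrightarrow> (\<forall>k\<in>J. wk k > 0)"

end

theory Submission
  imports Defs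
begin

text \<open>
  The surface average over a sphere and the sum over a shell are both invariant under signed
  permutations of the coordinates, and multiplying the integrand by the squared norm multiplies both by
  the squared radius.  For a functional \<open>L\<close> with these two properties and \<open>L 1 = 0\<close>, such as the
  difference of a shell sum and the corresponding multiple of the sphere average, monomials with
  an odd exponent are mapped to 0, and the values on all monomials of degree at most 7 are fixed linear
  combinations of \<open>L (x\<^sub>i ^ 4)\<close>, \<open>\<rho>\<^sup>2 * L (x\<^sub>i ^ 4)\<close> and \<open>L (x\<^sub>i ^ 6)\<close>.  So being a 5-design is one
  linear equation in the weights, and being a 7-design is three.  The sphere moments follow
  from invariance under rotations of a coordinate plane.

  An 8-design is impossible: the polynomial
  \<open>x\<^sub>i ^ 6 * x\<^sub>j ^ 2 - x\<^sub>i ^ 4 * x\<^sub>j ^ 4\<close> vanishes on every shell but has positive average on every sphere.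

  For shells of a common radius, the two remaining equations have the \<open>2 \<times> 2\<close> minors
  \<open>(n + 2) * (k - l) * G(k, l)\<close>, so the existence of positive weights becomes a sign condition on \<open>G\<close>.
\<close>

section \<open>Invariance of Lebesgue measure under orthogonal maps\<close>

text \<open>Different shells may have different radii, and this shapes the reduction: the
  coefficients belonging to a monomial must be the same for all shells, so the radius can enter only
  through the separate quantity \<open>\<rho>\<^sup>2 * L (x\<^sub>i ^ 4)\<close>. Degree 6
  therefore adds two equations to the one of degree 4. Absorbing the size of the shell,
  \<open>r_k ^ 6\<close> and \<open>1 / k ^ 2\<close> into the weight frees the degree 6 equations
  of all radii; only the degree 4 equation keeps a factor \<open>1 / r_k ^ 2\<close>. For three
  shells the degree 6 equations have one solution up to scale, the vector of cyclic minors. It can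
  be made positive iff the minors have one common strict sign, and inserting it into the degree 4
  equation gives the condition on the radii. Up to a positive summand, \<open>G(k, l)\<close> is
  \<open>(n + 2 - 3 k) (n + 2 - 3 l)\<close>. So \<open>G(k, l) \<le> 0\<close> puts
  \<open>k\<close> and \<open>l\<close> strictly on opposite sides of \<open>(n + 2) / 3\<close>.
  This rules out one of the two common signs, and for two shells it supplies the positivity of the
  weights.\<close>

text \<open>The change-of-variables theorems of HOL-Analysis assume a well-ordered index type, whereas the
  index type here is only finite; a copy of it with an arbitrary well-order bridges the gap.\<close>
typedef 'n wellordered = "UNIV :: 'n set"
  by simp

instance wellordered :: (finite) finite
proof
  have "range (Abs_wellordered :: 'a \<Rightarrow> 'a wellordered) = UNIV"
    by (metis Abs_wellordered_cases surjI UNIV_I)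
  then show "finite (UNIV :: 'a wellordered set)"
    by (metis finite finite_imageI)
qed

definition wellordered_rank :: "'n::finite wellordered \<Rightarrow> nat" where
  "wellordered_rank = (SOME f. inj f)"

lemma inj_wellordered_rank: "inj (wellordered_rank :: 'n::finite wellordered \<Rightarrow> nat)"
  unfolding wellordered_rank_def
  using finite_imp_inj_to_nat_seg[OF finite, of "UNIV :: 'n wellordered set"]
  by (intro someI_ex[of inj]) blast

instantiation wellordered :: (finite) wellorder
begin

definition "x \<le> y \<longleftrightarrow> wellordered_rank x \<le> wellordered_rank y"
definition "x < y \<longleftrightarrow> wellordered_rank x < wellordered_rank y"

instance
proof
  fix P :: "'a wellordered \<Rightarrow> bool" and a
  assume step: "\<And>x. (\<And>y. y < x \<Longrightarrow> P y) \<Longrightarrow> P x"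
  show "P a"
    by (induction a rule: measure_induct_rule[where f = wellordered_rank])
       (use step in \<open>auto simp: less_wellordered_def\<close>)
qed (auto simp: less_eq_wellordered_def less_wellordered_def inj_eq[OF inj_wellordered_rank])

end

text \<open>Renaming coordinates maps boxes to boxes with the same side lengths, and boxes determine
  \<open>lborel\<close>. This carries the measure from the well-ordered copy of the index type back
  to the original.\<close>

lemma lborel_reindex:
  fixes p :: "'n::finite \<Rightarrow> 'm::finite"
  assumes p: "bij p"
  shows "distr lborel borel (\<lambda>x :: real^'m. \<chi> i. x $ p i) = (lborel :: (real^'n) measure)"
proof (rule lborel_eqI[symmetric])
  let ?T = "\<lambda>x :: real^'m. (\<chi> i. x $ p i) :: real^'n"
  have "continuous_on UNIV ?T"
    by (intro continuous_intros)
  then have [measurable]: "?T \<in> borel \<rightarrow>\<^sub>M borel"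
    by (rule borel_measurable_continuous_onI)
  fix l u :: "real^'n"
  assume le: "\<And>b. b \<in> Basis \<Longrightarrow> l \<bullet> b \<le> u \<bullet> b"
  let ?S = "\<lambda>x :: real^'n. (\<chi> j. x $ inv p j) :: real^'m"
  have le': "l $ i \<le> u $ i" for i
    using le[of "axis i 1"] by (simp add: inner_axis)
  have "p (inv p j) = j" "inv p (p i) = i" for i j
    using p by (simp_all add: bij_is_surj surj_f_inv_f bij_is_inj)
  then have vim: "?T -` box l u = box (?S l) (?S u)"
    by (auto simp: mem_box_cart) metis+
  have "emeasure (distr lborel borel ?T) (box l u) = emeasure lborel (box (?S l) (?S u))"
    by (simp add: emeasure_distr vim)
  also have "\<dots> = (\<Prod>b\<in>Basis. (?S u - ?S l) \<bullet> b)"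
    using le' by (intro emeasure_lborel_box) (auto simp: Basis_vec_def inner_axis)
  also have "(\<Prod>b\<in>Basis. (?S u - ?S l) \<bullet> b) = (\<Prod>j\<in>UNIV. u $ inv p j - l $ inv p j)"
    by (simp add: Basis_vec_def UNION_singleton_eq_range prod.reindex axis_eq_axis inj_on_def inner_axis)
  also have "\<dots> = (\<Prod>i\<in>UNIV. u $ i - l $ i)"
    using bij_imp_bij_inv[OF p] by (intro prod.reindex_bij_betw) simp
  also have "\<dots> = (\<Prod>b\<in>Basis. (u - l) \<bullet> b)"
    by (simp add: Basis_vec_def UNION_singleton_eq_range prod.reindex axis_eq_axis inj_on_def inner_axis)
  finally show "emeasure (distr lborel borel ?T) (box l u) = (\<Prod>b\<in>Basis. (u - l) \<bullet> b)" .
qed simp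

lemma borel_measurable_orthogonal_transformation:
  fixes T :: "'a::euclidean_space \<Rightarrow> 'a"
  assumes "orthogonal_transformation T"
  shows "T \<in> borel \<rightarrow>\<^sub>M borel"
  using assms
  by (simp add: borel_measurable_continuous_onI linear_continuous_on linear_linear
      orthogonal_transformation_linear)

lemma lborel_orthogonal_transformation_wellorder:
  fixes T :: "real^'n::{finite,wellorder} \<Rightarrow> real^'n::_"
  assumes T: "orthogonal_transformation T"
  shows "distr lborel borel T = lborel"
proof (rule lborel_eqI[symmetric])
  note [measurable] = borel_measurable_orthogonal_transformation[OF T]
  fix l u :: "(real, 'n) vec"
  assume le: "\<And>b. b \<in> Basis \<Longrightarrow> l \<bullet> b \<le> u \<bullet> b"
  have T': "orthogonal_transformation (inv T)"
    by (rule orthogonal_transformation_inv[OF T])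
  have vim: "T -` box l u = inv T ` box l u"
    by (rule bij_vimage_eq_inv_image[OF orthogonal_transformation_bij[OF T]])
  have sets: "T -` box l u \<in> sets borel"
    using measurable_sets_borel[OF borel_measurable_orthogonal_transformation[OF T]] by simp
  have lm: "T -` box l u \<in> lmeasurable"
    unfolding vim by (rule measurable_orthogonal_image[OF T']) simp
  have "emeasure (distr lborel borel T) (box l u) = emeasure lebesgue (T -` box l u)"
    using sets by (simp add: emeasure_distr)
  also have "\<dots> = measure lebesgue (box l u)"
    using lm measure_orthogonal_image[OF T', of "box l u"]
    by (simp add: emeasure_eq_measure2 vim)
  also have "\<dots> = (\<Prod>b\<in>Basis. (u - l) \<bullet> b)"
    using le by (simp add: measure_lborel_box_eq)
  finally show "emeasure (distr lborel borel T) (box l u) = (\<Prod>b\<in>Basis. (u - l) \<bullet> b)" .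
qed simp

text \<open>The conjugate \<open>\<Psi> \<circ> T \<circ> \<Phi>\<close> is an orthogonal map over
  the well-ordered copy. Since \<open>\<Phi> \<circ> \<Psi>\<close> is the identity, \<open>T
  \<circ> \<Phi> = \<Phi> \<circ> (\<Psi> \<circ> T \<circ> \<Phi>)\<close>, and both factors on the
  right preserve \<open>lborel\<close>.\<close>

lemma lborel_orthogonal_transformation:
  fixes T :: "real^'n::finite \<Rightarrow> real^'n::_"
  assumes T: "orthogonal_transformation T"
  shows "distr lborel borel T = lborel"
proof -
  define \<Phi> where "\<Phi> = (\<lambda>x :: real^'n wellordered. (\<chi> i. x $ Abs_wellordered i) :: real^'n)"
  define \<Psi> where "\<Psi> = (\<lambda>x :: real^'n. (\<chi> i. x $ Rep_wellordered i) :: real^'n wellordered)"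
  have bij: "bij (Abs_wellordered :: 'n \<Rightarrow> 'n wellordered)"
    by (metis Abs_wellordered_inject UNIV_I bijI' Abs_wellordered_cases)
  have bij': "bij (Rep_wellordered :: 'n wellordered \<Rightarrow> 'n)"
    by (metis Rep_wellordered_inject UNIV_I bijI' Abs_wellordered_inverse)
  have inverse: "\<Phi> (\<Psi> x) = x" for x
    by (simp add: \<Phi>_def \<Psi>_def vec_eq_iff Abs_wellordered_inverse)
  have lin: "linear \<Phi>" "linear \<Psi>"
    by (auto simp: \<Phi>_def \<Psi>_def linear_iff vec_eq_iff)
  have inner: "\<Phi> x \<bullet> \<Phi> y = x \<bullet> y" for x y
    unfolding inner_vec_def \<Phi>_def
    using sum.reindex_bij_betw[OF bij, of "\<lambda>i. x $ i \<bullet> y $ i"] by simp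
  have inner': "\<Psi> x \<bullet> \<Psi> y = x \<bullet> y" for x y
    unfolding inner_vec_def \<Psi>_def
    using sum.reindex_bij_betw[OF bij', of "\<lambda>i. x $ i \<bullet> y $ i"] by simp
  have [measurable]: "\<Phi> \<in> borel \<rightarrow>\<^sub>M borel" "\<Psi> \<in> borel \<rightarrow>\<^sub>M borel"
    using lin by (simp_all add: borel_measurable_continuous_onI linear_continuous_on linear_linear)
  note [measurable] = borel_measurable_orthogonal_transformation[OF T]
  have orth: "orthogonal_transformation (\<Psi> \<circ> T \<circ> \<Phi>)"
    using T lin inner inner'
    by (auto simp: orthogonal_transformation_def intro!: linear_compose)
  have \<Phi>: "distr lborel borel \<Phi> = lborel"
    unfolding \<Phi>_def by (rule lborel_reindex[OF bij])
  have "distr lborel borel T = distr (distr lborel borel \<Phi>) borel T"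
    by (simp add: \<Phi>)
  also have "\<dots> = distr (distr lborel borel (\<Psi> \<circ> T \<circ> \<Phi>)) borel \<Phi>"
    by (simp add: distr_distr o_def inverse)
  also have "\<dots> = lborel"
    by (simp add: lborel_orthogonal_transformation_wellorder[OF orth] \<Phi>)
  finally show ?thesis .
qed

section \<open>Averages over spheres\<close>

lemma norm_radial_projection:
  fixes x :: "'a::real_normed_vector"
  assumes "x \<noteq> 0"
  shows "norm (r *\<^sub>R (x /\<^sub>R norm x)) = \<bar>r\<bar>"
  using assms by (simp add: abs_mult)

lemma sphere_integrand_integrable:
  fixes f :: "real^'n::finite \<Rightarrow> real"
  assumes f: "continuous_on UNIV f"
  shows "set_integrable lborel (ball 0 1) (\<lambda>x. f (r *\<^sub>R (x /\<^sub>R norm x)))"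
proof -
  have [measurable]: "f \<in> borel_measurable borel"
    using f by (rule borel_measurable_continuous_onI)
  have "(\<lambda>x :: real^'n. r *\<^sub>R (x /\<^sub>R norm x)) \<in> borel \<rightarrow>\<^sub>M borel"
    by (intro borel_measurable_scaleR borel_measurable_const borel_measurable_inverse
        borel_measurable_norm) auto
  then have meas: "(\<lambda>x. f (r *\<^sub>R (x /\<^sub>R norm x))) \<in> borel_measurable borel"
    by (rule measurable_compose) measurable
  \<comment> \<open>The closed ball instead of the sphere, because \<open>inverse 0 = 0\<close>
    makes the integrand at \<open>x = 0\<close> take the value of \<open>f\<close> at the
    centre.\<close>
  have "compact (f ` cball 0 \<bar>r\<bar>)"
    using f by (intro compact_continuous_image) (auto intro: continuous_on_subset)
  then obtain B where B: "\<And>y. y \<in> cball 0 \<bar>r\<bar> \<Longrightarrow> norm (f y) \<le> B"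
    by (meson bounded_iff compact_imp_bounded imageI)
  have "r *\<^sub>R (x /\<^sub>R norm x) \<in> cball 0 \<bar>r\<bar>" for x :: "real^'n"
    using norm_radial_projection[of x r] by (cases "x = 0") auto
  then have bd: "norm (f (r *\<^sub>R (x /\<^sub>R norm x))) \<le> B" for x
    using B by blast
  show ?thesis
    unfolding set_integrable_def
  proof (rule integrableI_bounded_set[where A = "ball 0 1" and B = B])
    show "emeasure lborel (ball (0 :: real^'n) 1) < \<infinity>"
      by (rule emeasure_lborel_ball_finite)
    show "(\<lambda>x. indicat_real (ball 0 1) x *\<^sub>R f (r *\<^sub>R (x /\<^sub>R norm x))) \<in> borel_measurable lborel"
      by (intro borel_measurable_scaleR borel_measurable_indicator) (simp_all add: meas)
    show "AE x in lborel. x \<in> ball 0 1 \<longrightarrow>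
        norm (indicat_real (ball 0 1) x *\<^sub>R f (r *\<^sub>R (x /\<^sub>R norm x))) \<le> B"
      using bd by (intro AE_I2) (simp add: indicator_def)
  qed auto
qed

text \<open>\<open>sphere_avg\<close> is defined by the gauge integral, while invariance of a
  measure under a map is a statement about the Lebesgue integral.\<close>

lemma sphere_avg_lborel:
  fixes f :: "real^'n::finite \<Rightarrow> real"
  assumes "continuous_on UNIV f"
  shows "sphere_avg f r = (LINT x:ball 0 1|lborel. f (r *\<^sub>R (x /\<^sub>R norm x))) / measure lebesgue (ball (0 :: real^'n) 1)"
  using set_borel_integral_eq_integral(2)[OF sphere_integrand_integrable[OF assms]]
  by (simp add: sphere_avg_def)

lemma measure_unit_ball_pos: "measure lebesgue (ball (0 :: real^'n::finite) 1) > 0"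
  using content_ball_pos[of 1 "0 :: real^'n"] by simp

lemma sphere_avg_cmult:
  fixes f :: "real^'n::finite \<Rightarrow> real"
  shows "sphere_avg (\<lambda>x. c * f x) r = c * sphere_avg f r"
  by (simp add: sphere_avg_def)

lemma sphere_avg_sum:
  fixes f :: "'b \<Rightarrow> real^'n::finite \<Rightarrow> real"
  assumes "finite A" "\<And>a. a \<in> A \<Longrightarrow> continuous_on UNIV (f a)"
  shows "sphere_avg (\<lambda>x. \<Sum>a\<in>A. f a x) r = (\<Sum>a\<in>A. sphere_avg (f a) r)"
proof -
  have "integral (ball 0 1) (\<lambda>x. \<Sum>a\<in>A. f a (r *\<^sub>R (x /\<^sub>R norm x))) =
      (\<Sum>a\<in>A. integral (ball 0 1) (\<lambda>x. f a (r *\<^sub>R (x /\<^sub>R norm x))))"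
    using assms set_borel_integral_eq_integral(1)[OF sphere_integrand_integrable]
    by (intro integral_sum) auto
  then show ?thesis
    by (simp add: sphere_avg_def sum_divide_distrib)
qed

lemma sphere_avg_diff:
  fixes f g :: "real^'n::finite \<Rightarrow> real"
  assumes "continuous_on UNIV f" "continuous_on UNIV g"
  shows "sphere_avg (\<lambda>x. f x - g x) r = sphere_avg f r - sphere_avg g r"
  unfolding sphere_avg_def diff_divide_distrib[symmetric]
  using assms set_borel_integral_eq_integral(1)[OF sphere_integrand_integrable]
  by (subst integral_diff) auto

lemma sphere_avg_mono:
  fixes f g :: "real^'n::finite \<Rightarrow> real"
  assumes "continuous_on UNIV f" "continuous_on UNIV g" "\<And>x. f x \<le> g x"
  shows "sphere_avg f r \<le> sphere_avg g r"
  unfolding sphere_avg_def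
  using assms set_borel_integral_eq_integral(1)[OF sphere_integrand_integrable]
  by (intro divide_right_mono integral_le) auto

lemma sphere_avg_const: "sphere_avg (\<lambda>_ :: real^'n::finite. c) r = c"
  using measure_unit_ball_pos[where 'n = 'n] sphere_avg_cmult[of c "\<lambda>_ :: real^'n. 1" r]
    lmeasure_integral[OF lmeasurable_ball, of "0 :: real^'n" 1]
  by (simp add: sphere_avg_def)

lemma sphere_avg_norm:
  fixes f :: "real^'n::finite \<Rightarrow> real"
  shows "sphere_avg (\<lambda>x. (norm x)\<^sup>2 * f x) r = r\<^sup>2 * sphere_avg f r"
proof -
  \<comment> \<open>The integrands can differ only at the origin, where the projected point has norm
    \<open>0\<close> and not \<open>\<bar>r\<bar>\<close>.\<close>
  have "integral (ball 0 1) (\<lambda>x :: real^'n. (norm (r *\<^sub>R (x /\<^sub>R norm x)))\<^sup>2 * f (r *\<^sub>R (x /\<^sub>R norm x))) =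
      integral (ball 0 1) (\<lambda>x. r\<^sup>2 * f (r *\<^sub>R (x /\<^sub>R norm x)))"
    by (intro integral_spike[of "{0}"])
       (auto simp: norm_radial_projection simp del: norm_scaleR scaleR_scaleR)
  then show ?thesis
    by (simp add: sphere_avg_def)
qed

text \<open>An orthogonal map preserves the unit ball and commutes with radial projection, so
  invariance of \<open>lborel\<close> passes to the average.\<close>

lemma sphere_avg_orthogonal_transformation:
  fixes f :: "real^'n::finite \<Rightarrow> real" and T :: "real^'n \<Rightarrow> real^'n"
  assumes f: "continuous_on UNIV f" and T: "orthogonal_transformation T"
  shows "sphere_avg (\<lambda>x. f (T x)) r = sphere_avg f r"
proof -
  have [measurable]: "f \<in> borel_measurable borel"
    using f by (rule borel_measurable_continuous_onI)
  note [measurable] = borel_measurable_orthogonal_transformation[OF T]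
  have cont: "continuous_on UNIV (\<lambda>x. f (T x))"
    using T f
    by (intro continuous_on_compose2[OF f] linear_continuous_on)
       (auto simp: linear_linear orthogonal_transformation_linear)
  have norm: "norm (T x) = norm x" for x
    using T by (simp add: orthogonal_transformation_norm)
  have scale: "T (c *\<^sub>R x) = c *\<^sub>R T x" for c x
    using T by (simp add: orthogonal_transformation_scaleR)
  have "(LINT x:ball 0 1|lborel. f (r *\<^sub>R (x /\<^sub>R norm x))) =
      (\<integral>x. indicat_real (ball 0 1) x *\<^sub>R f (r *\<^sub>R (x /\<^sub>R norm x)) \<partial>(distr lborel borel T))"
    by (simp add: set_lebesgue_integral_def lborel_orthogonal_transformation[OF T])
  also have "\<dots> = (\<integral>x. indicat_real (ball 0 1) (T x) *\<^sub>R f (r *\<^sub>R (T x /\<^sub>R norm (T x))) \<partial>lborel)"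
    using borel_measurable_integrable[OF sphere_integrand_integrable[OF f, unfolded set_integrable_def]]
    by (intro integral_distr) simp_all
  also have "\<dots> = (LINT x:ball 0 1|lborel. f (T (r *\<^sub>R (x /\<^sub>R norm x))))"
    by (simp add: set_lebesgue_integral_def norm scale indicator_def)
  finally show ?thesis
    by (simp add: sphere_avg_lborel[OF f] sphere_avg_lborel[OF cont])
qed

lemma orthogonal_transformation_signed_permutation:
  fixes s :: "'n::finite \<Rightarrow> real"
  assumes p: "bij p" and s: "\<And>l. s l \<in> {1, -1}"
  shows "orthogonal_transformation (\<lambda>x :: real^'n. \<chi> l. s l * x $ p l)"
  unfolding orthogonal_transformation_def
proof (intro conjI allI)
  show "linear (\<lambda>x :: real^'n. \<chi> l. s l * x $ p l)"
    by (auto simp: linear_iff vec_eq_iff algebra_simps)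
  have s': "s l * a * (s l * b) = a * b" for l a b
    using s[of l] by auto
  show "(\<chi> l. s l * v $ p l) \<bullet> (\<chi> l. s l * w $ p l) = v \<bullet> w" for v w :: "real^'n"
    using sum.reindex_bij_betw[OF p, of "\<lambda>l. v $ l * w $ l"]
    by (simp only: inner_vec_def inner_real_def vec_lambda_beta s')
qed

lemma orthogonal_transformation_plane_rotation:
  fixes i j :: "'n::finite" and c s :: real
  assumes ij: "i \<noteq> j" and cs: "c\<^sup>2 + s\<^sup>2 = 1"
  shows "orthogonal_transformation (\<lambda>x :: real^'n. \<chi> l. if l = i then c * x $ i + s * x $ j
           else if l = j then c * x $ j - s * x $ i else x $ l)"
    (is "orthogonal_transformation ?T")
  unfolding orthogonal_transformation_def
proof (intro conjI allI)
  show "linear ?T"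
    by (auto simp: linear_iff vec_eq_iff algebra_simps)
  fix v w :: "real^'n"
  have split: "(\<Sum>l\<in>UNIV. g l) = g i + (g j + (\<Sum>l\<in>UNIV - {i} - {j}. g l))" for g :: "'n \<Rightarrow> real"
    using ij by (simp add: sum.remove[of UNIV i] sum.remove[of "UNIV - {i}" j])
  have rest: "(\<Sum>l\<in>UNIV - {i} - {j}. ?T v $ l * ?T w $ l) = (\<Sum>l\<in>UNIV - {i} - {j}. v $ l * w $ l)"
    by (rule sum.cong) auto
  have cs': "c * c = 1 - s * s"
    using cs by (simp add: power2_eq_square)
  have "(c * a + s * b) * (c * a' + s * b') + (c * b - s * a) * (c * b' - s * a')
      = a * a' + b * b'" for a b a' b'
  proof -
    have "(c * a + s * b) * (c * a' + s * b') + (c * b - s * a) * (c * b' - s * a')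
        = (c * c + s * s) * (a * a' + b * b')"
      by (simp add: algebra_simps)
    then show ?thesis
      by (simp add: cs')
  qed
  from this[of "v $ i" "v $ j" "w $ i" "w $ j"] show "?T v \<bullet> ?T w = v \<bullet> w"
    unfolding inner_vec_def inner_real_def split rest using ij by simp
qed

section \<open>Octahedral functionals and sphere moments\<close>

text \<open>Here \<open>\<rho>2\<close> is the squared radius, and \<open>norm_square\<close> says
  that multiplying by the squared norm multiplies the value by \<open>\<rho>2\<close>, with the norm
  already expanded over the coordinates. In this form the moment identities follow from symmetry and
  counting of equal summands, with \<open>uminus\<close> as the only trace of linearity.\<close>

locale octahedral_functional =
  fixes L :: "(real^'n::finite \<Rightarrow> real) \<Rightarrow> real" and \<rho>2 :: real
  assumes uminus: "continuous_on UNIV f \<Longrightarrow> L (\<lambda>x. - f x) = - L f"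
    and signed_permutation: "continuous_on UNIV f \<Longrightarrow> bij p \<Longrightarrow> (\<And>l. s l \<in> {1, -1}) \<Longrightarrow>
      L (\<lambda>x. f (\<chi> l. s l * x $ p l)) = L f"
    and norm_square: "continuous_on UNIV f \<Longrightarrow> (\<Sum>j\<in>UNIV. L (\<lambda>x. (x $ j)\<^sup>2 * f x)) = \<rho>2 * L f"
begin

lemma swap:
  assumes "continuous_on UNIV f"
  shows "L (\<lambda>x. f (\<chi> l. x $ Transposition.transpose i j l)) = L f"
  using signed_permutation[OF assms, of "Transposition.transpose i j" "\<lambda>_. 1"] by simp

lemma odd_eq_0:
  assumes "continuous_on UNIV f"
    and "\<And>x. f (\<chi> l. (if l = i then - 1 else 1) * x $ l) = - f x"
  shows "L f = 0"
  using signed_permutation[OF assms(1), of id "\<lambda>l. if l = i then - 1 else 1"] uminus[OF assms(1)]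
  by (simp add: assms(2) bij_id)

lemma power_moment_eq: "L (\<lambda>x. (x $ i) ^ a) = L (\<lambda>x. (x $ j) ^ a)"
  using swap[of "\<lambda>x. (x $ i) ^ a" i j, OF continuous_on_power[OF continuous_on_component[OF continuous_on_id]]]
  by simp

lemma second_moment: "real CARD('n) * L (\<lambda>x. (x $ i)\<^sup>2) = \<rho>2 * L (\<lambda>_. 1)"
proof -
  have "(\<Sum>j\<in>UNIV. L (\<lambda>x. (x $ j)\<^sup>2)) = (\<Sum>j\<in>(UNIV :: 'n set). L (\<lambda>x. (x $ i)\<^sup>2))"
    by (intro sum.cong refl power_moment_eq)
  then show ?thesis
    using norm_square[of "\<lambda>_. 1"] by simp
qed

text \<open>Apply \<open>norm_square\<close> to \<open>x\<^sub>i ^ a\<close>: the summand at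
  \<open>i\<close> raises the exponent by 2, and the other \<open>n - 1\<close> summands agree by a
  transposition that fixes \<open>i\<close>.\<close>

lemma pair_moment:
  assumes "i \<noteq> j"
  shows "(real CARD('n) - 1) * L (\<lambda>x. (x $ i) ^ a * (x $ j)\<^sup>2) =
    \<rho>2 * L (\<lambda>x. (x $ i) ^ a) - L (\<lambda>x. (x $ i) ^ (a + 2))"
proof -
  have eq: "L (\<lambda>x. (x $ l)\<^sup>2 * (x $ i) ^ a) = L (\<lambda>x. (x $ i) ^ a * (x $ j)\<^sup>2)" if "l \<noteq> i" for l
  proof -
    have "continuous_on UNIV (\<lambda>x :: real^'n. (x $ i) ^ a * (x $ j)\<^sup>2)"
      by (intro continuous_intros)
    from swap[OF this, of l j] show ?thesis
      using that assms by (simp add: mult.commute)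
  qed
  have "\<rho>2 * L (\<lambda>x. (x $ i) ^ a) = (\<Sum>l\<in>UNIV. L (\<lambda>x. (x $ l)\<^sup>2 * (x $ i) ^ a))"
    by (rule norm_square[symmetric]) (intro continuous_intros)
  also have "\<dots> = L (\<lambda>x. (x $ i)\<^sup>2 * (x $ i) ^ a) + (\<Sum>l\<in>UNIV - {i}. L (\<lambda>x. (x $ l)\<^sup>2 * (x $ i) ^ a))"
    by (simp add: sum.remove)
  also have "(\<Sum>l\<in>UNIV - {i}. L (\<lambda>x. (x $ l)\<^sup>2 * (x $ i) ^ a)) =
      (real CARD('n) - 1) * L (\<lambda>x. (x $ i) ^ a * (x $ j)\<^sup>2)"
    using eq by (simp add: card_Diff_singleton of_nat_diff)
  also have "(\<lambda>x :: real^'n. (x $ i)\<^sup>2 * (x $ i) ^ a) = (\<lambda>x. (x $ i) ^ (a + 2))"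
    by (simp add: power_add power2_eq_square mult_ac)
  finally show ?thesis
    by simp
qed

text \<open>The same count for \<open>x\<^sub>i\<^sup>2 * x\<^sub>j\<^sup>2\<close>: two exceptional
  summands, at \<open>i\<close> and \<open>j\<close>, and \<open>n - 2\<close> equal ones.\<close>

lemma triple_moment:
  assumes "i \<noteq> j" "i \<noteq> k" "j \<noteq> k"
  shows "(real CARD('n) - 2) * L (\<lambda>x. (x $ i)\<^sup>2 * (x $ j)\<^sup>2 * (x $ k)\<^sup>2) =
    \<rho>2 * L (\<lambda>x. (x $ i)\<^sup>2 * (x $ j)\<^sup>2) - L (\<lambda>x. (x $ i) ^ 4 * (x $ j)\<^sup>2) - L (\<lambda>x. (x $ j) ^ 4 * (x $ i)\<^sup>2)"
proof -
  let ?f = "\<lambda>l (x :: real^'n). (x $ l)\<^sup>2 * ((x $ i)\<^sup>2 * (x $ j)\<^sup>2)"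
  have eq: "L (?f l) = L (\<lambda>x. (x $ i)\<^sup>2 * (x $ j)\<^sup>2 * (x $ k)\<^sup>2)" if "l \<noteq> i" "l \<noteq> j" for l
  proof -
    have "continuous_on UNIV (\<lambda>x :: real^'n. (x $ i)\<^sup>2 * (x $ j)\<^sup>2 * (x $ k)\<^sup>2)"
      by (intro continuous_intros)
    from swap[OF this, of l k] show ?thesis
      using that assms by (simp add: mult_ac)
  qed
  have card: "card (UNIV - {i} - {j}) = CARD('n) - 2" "CARD('n) \<ge> 2"
    using assms card_mono[of "UNIV :: 'n set" "{i, j}"] by (simp_all add: card_Diff_singleton)
  have "\<rho>2 * L (\<lambda>x. (x $ i)\<^sup>2 * (x $ j)\<^sup>2) = (\<Sum>l\<in>UNIV. L (?f l))"
    by (rule norm_square[symmetric]) (intro continuous_intros)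
  also have "\<dots> = L (?f i) + (L (?f j) + (\<Sum>l\<in>UNIV - {i} - {j}. L (?f l)))"
    using assms by (simp add: sum.remove[of UNIV i] sum.remove[of "UNIV - {i}" j])
  also have "(\<Sum>l\<in>UNIV - {i} - {j}. L (?f l)) =
      (real CARD('n) - 2) * L (\<lambda>x. (x $ i)\<^sup>2 * (x $ j)\<^sup>2 * (x $ k)\<^sup>2)"
    using eq card by (simp add: of_nat_diff)
  also have "?f i = (\<lambda>x. (x $ i) ^ 4 * (x $ j)\<^sup>2)"
    by (rule ext) (simp add: power4_eq_xxxx power2_eq_square mult_ac)
  also have "?f j = (\<lambda>x. (x $ j) ^ 4 * (x $ i)\<^sup>2)"
    by (rule ext) (simp add: power4_eq_xxxx power2_eq_square mult_ac)
  finally show ?thesis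
    by simp
qed

end

lemma octahedral_functional_diff:
  assumes "octahedral_functional L \<rho>2" "octahedral_functional M \<rho>2"
  shows "octahedral_functional (\<lambda>f. L f - c * M f) \<rho>2"
proof -
  interpret L: octahedral_functional L \<rho>2 by fact
  interpret M: octahedral_functional M \<rho>2 by fact
  show ?thesis
    by unfold_locales
       (simp_all add: L.uminus M.uminus L.signed_permutation M.signed_permutation
         L.norm_square M.norm_square sum_subtractf sum_distrib_left[symmetric] right_diff_distrib)
qed

section \<open>Moments of spheres from rotations of a coordinate plane\<close>

lemma octahedral_functional_sphere_avg:
  "octahedral_functional (\<lambda>f :: real^'n::finite \<Rightarrow> real. sphere_avg f r) (r\<^sup>2)"
proof
  fix f :: "real^'n \<Rightarrow> real"
  assume f: "continuous_on UNIV f"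
  show "sphere_avg (\<lambda>x. - f x) r = - sphere_avg f r"
    using sphere_avg_cmult[of "-1" f r] by simp
  show "sphere_avg (\<lambda>x. f (\<chi> l. s l * x $ p l)) r = sphere_avg f r"
    if "bij p" "\<And>l. s l \<in> {1, -1}" for p :: "'n \<Rightarrow> 'n" and s :: "'n \<Rightarrow> real"
    by (intro sphere_avg_orthogonal_transformation[OF f] orthogonal_transformation_signed_permutation that)
  have "(\<Sum>j\<in>UNIV. sphere_avg (\<lambda>x. (x $ j)\<^sup>2 * f x) r) =
      sphere_avg (\<lambda>x. \<Sum>j\<in>UNIV. (x $ j)\<^sup>2 * f x) r"
    by (intro sphere_avg_sum[symmetric] continuous_intros f) simp
  also have "(\<lambda>x. \<Sum>j\<in>UNIV. (x $ j)\<^sup>2 * f x) = (\<lambda>x. (norm x)\<^sup>2 * f x)"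
    by (simp only: power2_norm_eq_inner inner_vec_def inner_real_def sum_distrib_right) (simp add: power2_eq_square)
  finally show "(\<Sum>j\<in>UNIV. sphere_avg (\<lambda>x. (x $ j)\<^sup>2 * f x) r) = r\<^sup>2 * sphere_avg f r"
    by (simp add: sphere_avg_norm)
qed

text \<open>The rotation sends \<open>x\<^sub>i\<close> to
  \<open>c * x\<^sub>i + s * x\<^sub>j\<close>. Expanding the power turns every choice of
  \<open>c\<close> and \<open>s\<close> into a linear relation between the moments of degree
  \<open>d\<close> in two coordinates.\<close>

lemma sphere_avg_power_rotation:
  fixes i j :: "'n::finite"
  assumes "i \<noteq> j" "c\<^sup>2 + s\<^sup>2 = 1"
  shows "sphere_avg (\<lambda>x. (x $ i) ^ d) r =
    (\<Sum>m\<le>d. real (d choose m) * c ^ m * s ^ (d - m) * sphere_avg (\<lambda>x. (x $ i) ^ m * (x $ j) ^ (d - m)) r)"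
proof -
  have "sphere_avg (\<lambda>x. (x $ i) ^ d) r = sphere_avg (\<lambda>x. (c * x $ i + s * x $ j) ^ d) r"
    using sphere_avg_orthogonal_transformation[OF _ orthogonal_transformation_plane_rotation[OF assms],
        of "\<lambda>x. (x $ i) ^ d" r, OF continuous_on_power[OF continuous_on_component[OF continuous_on_id]]]
    by simp
  also have "\<dots> = sphere_avg (\<lambda>x. \<Sum>m\<le>d. (real (d choose m) * c ^ m * s ^ (d - m)) *
      ((x $ i) ^ m * (x $ j) ^ (d - m))) r"
    by (simp add: binomial_ring power_mult_distrib mult_ac)
  also have "\<dots> = (\<Sum>m\<le>d. sphere_avg (\<lambda>x. (real (d choose m) * c ^ m * s ^ (d - m)) *
      ((x $ i) ^ m * (x $ j) ^ (d - m))) r)"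
    by (intro sphere_avg_sum continuous_intros) simp
  finally show ?thesis
    by (simp only: sphere_avg_cmult)
qed

context
  fixes r :: real and i j :: "'n::finite"
  assumes ij: "i \<noteq> j"
begin

interpretation octahedral_functional "\<lambda>f :: real^'n \<Rightarrow> real. sphere_avg f r" "r\<^sup>2"
  by (rule octahedral_functional_sphere_avg)

private definition M :: "nat \<Rightarrow> nat \<Rightarrow> real" where
  "M a b = sphere_avg (\<lambda>x. (x $ i) ^ a * (x $ j) ^ b) r"

private lemma M_odd:
  assumes "odd a"
  shows "M a b = 0"
  unfolding M_def using assms ij
  by (intro odd_eq_0[where i = i]) (auto intro!: continuous_intros)

private lemma M_commute: "M a b = M b a"
proof -
  have "continuous_on UNIV (\<lambda>x :: real^'n. (x $ i) ^ a * (x $ j) ^ b)"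
    by (intro continuous_intros)
  from swap[OF this, of i j] show ?thesis
    unfolding M_def by (simp add: mult.commute)
qed

private lemma M_rotation:
  assumes "c\<^sup>2 + s\<^sup>2 = 1"
  shows "M d 0 = (\<Sum>m\<le>d. real (d choose m) * c ^ m * s ^ (d - m) * M m (d - m))"
  using sphere_avg_power_rotation[OF ij assms, of d r] by (simp add: M_def)

text \<open>Rotations by two rational angles already determine the ratios of the moments up to degree 8.\<close>
private lemma pythagorean_triples:
  "(3/5 :: real)\<^sup>2 + (4/5)\<^sup>2 = 1" "(5/13 :: real)\<^sup>2 + (12/13)\<^sup>2 = 1"
  by (simp_all add: power2_eq_square)

text \<open>After the odd moments are dropped, the relation reads
  \<open>(1 - c^4 - s^4) * M 4 0 = 6 * c^2 * s^2 * M 2 2\<close>, and \<open>c^2 + s^2 = 1\<close>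
  gives \<open>1 - c^4 - s^4 = 2 * c^2 * s^2\<close>.\<close>

private lemma M_fourth: "M 4 0 = 3 * M 2 2"
proof -
  have "(\<Sum>m\<le>4. real (4 choose m) * c ^ m * s ^ (4 - m) * M m (4 - m)) =
      s^4 * M 0 4 + 4 * c * s^3 * M 1 3 + 6 * c^2 * s^2 * M 2 2 + 4 * c^3 * s * M 3 1 + c^4 * M 4 0" for c s
    by (simp add: eval_nat_numeral)
  note M_rotation[OF pythagorean_triples(1), of 4, unfolded this]
  then show ?thesis
    using M_commute[of 0 4] by (simp add: M_odd field_simps)
qed

text \<open>Here \<open>1 - c^6 - s^6 = 3 * c^2 * s^2\<close>, while the mixed terms add up to
  \<open>15 * c^2 * s^2 * M 4 2\<close>.\<close>

private lemma M_sixth: "M 6 0 = 5 * M 4 2"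
proof -
  have "(\<Sum>m\<le>6. real (6 choose m) * c ^ m * s ^ (6 - m) * M m (6 - m)) =
      s^6 * M 0 6 + 6 * c * s^5 * M 1 5 + 15 * c^2 * s^4 * M 2 4 + 20 * c^3 * s^3 * M 3 3
      + 15 * c^4 * s^2 * M 4 2 + 6 * c^5 * s * M 5 1 + c^6 * M 6 0" for c s
    by (simp add: eval_nat_numeral)
  note M_rotation[OF pythagorean_triples(1), of 6, unfolded this]
  then show ?thesis
    using M_commute[of 0 6] M_commute[of 2 4] by (simp add: M_odd field_simps)
qed

text \<open>With \<open>q = c^2 * s^2\<close> the relation is \<open>(4 - 2 * q) * M 8 0 = 28 * (1 -
  2 * q) * M 6 2 + 70 * q * M 4 4\<close>. It has two unknown ratios, so two angles with different
  \<open>q\<close> are taken.\<close>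

private lemma M_eighth: "M 8 0 = 7 * M 6 2" "3 * M 8 0 = 35 * M 4 4"
proof -
  have *: "(\<Sum>m\<le>8. real (8 choose m) * c ^ m * s ^ (8 - m) * M m (8 - m)) =
      s^8 * M 0 8 + 8 * c * s^7 * M 1 7 + 28 * c^2 * s^6 * M 2 6 + 56 * c^3 * s^5 * M 3 5
      + 70 * c^4 * s^4 * M 4 4 + 56 * c^5 * s^3 * M 5 3 + 28 * c^6 * s^2 * M 6 2 + 8 * c^7 * s * M 7 1
      + c^8 * M 8 0" for c s
    by (simp add: eval_nat_numeral)
  note M_rotation[OF pythagorean_triples(1), of 8, unfolded *]
    M_rotation[OF pythagorean_triples(2), of 8, unfolded *]
  then show "M 8 0 = 7 * M 6 2" "3 * M 8 0 = 35 * M 4 4"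
    using M_commute[of 0 8] M_commute[of 2 6] by (simp_all add: M_odd field_simps)
qed

text \<open>The rotation supplies the ratio of \<open>M 4 0\<close> and \<open>M 2 2\<close>, and
  \<open>pair_moment\<close> a second linear relation between them; together they fix the
  value.\<close>

lemma sphere_avg_fourth_moment:
  "sphere_avg (\<lambda>x. (x $ i) ^ 4) r = 3 * r ^ 4 / (real CARD('n) * (real CARD('n) + 2))"
proof -
  let ?n = "real CARD('n)"
  have "?n > 0"
    by simp
  have "?n * M 2 0 = r\<^sup>2" "(?n - 1) * M 2 2 = r\<^sup>2 * M 2 0 - M 4 0"
    using second_moment[of i] pair_moment[OF ij, of 2] by (simp_all add: M_def sphere_avg_const)
  then have "?n * (?n + 2) * M 4 0 = 3 * r ^ 4"
    using M_fourth by algebra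
  then show ?thesis
    using \<open>?n > 0\<close> by (subst nonzero_eq_divide_eq) (auto simp: M_def mult.commute)
qed

lemma sphere_avg_sixth_moment:
  "sphere_avg (\<lambda>x. (x $ i) ^ 6) r =
    15 * r ^ 6 / (real CARD('n) * (real CARD('n) + 2) * (real CARD('n) + 4))"
proof -
  let ?n = "real CARD('n)"
  have "?n > 0"
    by simp
  have "?n * (?n + 2) * M 4 0 = 3 * r ^ 4"
    using \<open>?n > 0\<close> by (simp add: M_def sphere_avg_fourth_moment)
  moreover have "(?n - 1) * M 4 2 = r\<^sup>2 * M 4 0 - M 6 0"
    using pair_moment[OF ij, of 4] by (simp add: M_def)
  ultimately have "?n * (?n + 2) * (?n + 4) * M 6 0 = 15 * r ^ 6"
    using M_sixth by algebra
  then show ?thesis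
    using \<open>?n > 0\<close> by (subst nonzero_eq_divide_eq) (auto simp: M_def mult.commute)
qed

text \<open>By \<open>M_eighth\<close> the two sides are \<open>3/35\<close> and \<open>5/35\<close>
  of \<open>M 8 0\<close>, so what remains is that \<open>M 8 0\<close> is positive.\<close>

lemma sphere_avg_eighth_moment_less:
  assumes "r > 0"
  shows "sphere_avg (\<lambda>x. (x $ i) ^ 4 * (x $ j) ^ 4) r < sphere_avg (\<lambda>x. (x $ i) ^ 6 * (x $ j) ^ 2) r"
proof -
  define c where "c = r\<^sup>2 / real CARD('n)"
  have "c > 0"
    using assms by (simp add: c_def)
  \<comment> \<open>Jensen's inequality for \<open>y \<mapsto> y ^ 4\<close> and \<open>y = x\<^sub>i\<^sup>2\<close>, in tangent form.\<close>
  have tangent: "4 * c ^ 3 * y - 3 * c ^ 4 \<le> y ^ 4" for y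
  proof -
    have "y ^ 4 - (4 * c ^ 3 * y - 3 * c ^ 4) = (y - c)\<^sup>2 * ((y + c)\<^sup>2 + 2 * c\<^sup>2)"
      by algebra
    also have "\<dots> \<ge> 0"
      by simp
    finally show ?thesis
      by simp
  qed
  have "sphere_avg (\<lambda>x. (x $ i)\<^sup>2) r = c"
    using second_moment[of i] by (simp add: sphere_avg_const c_def field_simps)
  then have "c ^ 4 = sphere_avg (\<lambda>x. 4 * c ^ 3 * (x $ i)\<^sup>2 - 3 * c ^ 4) r"
    by (subst sphere_avg_diff) (auto intro!: continuous_intros simp: sphere_avg_cmult sphere_avg_const power4_eq_xxxx power3_eq_cube)
  also have "\<dots> \<le> sphere_avg (\<lambda>x. ((x $ i)\<^sup>2) ^ 4) r"
    by (intro sphere_avg_mono tangent continuous_intros)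
  finally have "M 8 0 > 0"
    using less_le_trans[OF zero_less_power[OF \<open>c > 0\<close>, of 4]] by (simp add: M_def)
  then show ?thesis
    using M_eighth by (simp add: M_def)
qed

end

section \<open>Reduction of monomials of degree at most 7\<close>

definition vec_monomial :: "('n \<Rightarrow> nat) \<Rightarrow> real^'n::finite \<Rightarrow> real" where
  "vec_monomial \<alpha> x = (\<Prod>i\<in>UNIV. (x $ i) ^ \<alpha> i)"

lemma continuous_on_vec_monomial: "continuous_on UNIV (vec_monomial \<alpha>)"
  unfolding vec_monomial_def[abs_def] by (intro continuous_intros)

lemma vec_monomial_split:
  fixes x :: "real^'n::finite"
  shows "vec_monomial \<alpha> x = (x $ i) ^ \<alpha> i * (\<Prod>l\<in>UNIV - {i}. (x $ l) ^ \<alpha> l)"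
  by (simp add: vec_monomial_def prod.remove)

text \<open>The list contains each index \<open>i\<close> exactly \<open>\<alpha> i / 2\<close>
  times. It replaces a classification of exponent vectors by a case distinction on a list, which has
  at most three entries up to degree 7.\<close>

lemma vec_monomial_even:
  fixes \<alpha> :: "'n::finite \<Rightarrow> nat"
  assumes "\<And>i. even (\<alpha> i)"
  shows "\<exists>is. 2 * length is = sum \<alpha> UNIV \<and>
    vec_monomial \<alpha> = (\<lambda>x. prod_list (map (\<lambda>i. (x $ i)\<^sup>2) is))"
  using assms
proof (induction "sum \<alpha> UNIV" arbitrary: \<alpha> rule: less_induct)
  case less
  show ?case
  proof (cases "\<forall>i. \<alpha> i = 0")
    case True
    then show ?thesis
      by (intro exI[of _ "[]"]) (simp add: vec_monomial_def fun_eq_iff)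
  next
    case False
    then obtain i where "\<alpha> i \<noteq> 0"
      by blast
    with less.prems[of i] obtain m where m: "\<alpha> i = m + 2"
      by (metis add.commute add_2_eq_Suc even_Suc_Suc_iff evenE not0_implies_Suc odd_Suc_minus_one odd_one
          old.nat.exhaust One_nat_def)
    define \<beta> where "\<beta> = \<alpha>(i := m)"
    have sum: "sum \<alpha> UNIV = sum \<beta> UNIV + 2"
      by (simp add: sum.remove[of UNIV i] \<beta>_def m)
    have "even (\<beta> l)" for l
      using less.prems[of l] less.prems[of i] by (simp add: \<beta>_def m)
    with less.hyps[of \<beta>] sum obtain "is" where "is": "2 * length is = sum \<beta> UNIV"
        "vec_monomial \<beta> = (\<lambda>x. prod_list (map (\<lambda>i. (x $ i)\<^sup>2) is))"
      by auto
    have "vec_monomial \<alpha> x = (x $ i)\<^sup>2 * vec_monomial \<beta> x" for x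
      by (simp add: vec_monomial_split[of _ _ i] \<beta>_def m power2_eq_square)
    then show ?thesis
      using "is" sum by (intro exI[of _ "i # is"]) (auto simp: fun_eq_iff)
  qed
qed

context octahedral_functional
begin

lemma odd_monomial_eq_0:
  assumes "odd (\<alpha> i)"
  shows "L (vec_monomial \<alpha>) = 0"
proof (rule odd_eq_0[OF continuous_on_vec_monomial])
  have "(\<Prod>l\<in>UNIV - {i}. ((if l = i then - 1 else 1) * x $ l) ^ \<alpha> l) = (\<Prod>l\<in>UNIV - {i}. (x $ l) ^ \<alpha> l)"
    for x :: "real^'n"
    by (intro prod.cong) auto
  then show "vec_monomial \<alpha> (\<chi> l. (if l = i then - 1 else 1) * x $ l) = - vec_monomial \<alpha> x" for x
    using assms by (simp add: vec_monomial_split[of _ _ i])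
qed

context
  assumes n: "CARD('n) \<ge> 3" and null: "L (\<lambda>_. 1) = 0"
begin

lemma second_moment_eq_0: "L (\<lambda>x. (x $ i)\<^sup>2) = 0"
  using second_moment[of i] null by simp

text \<open>When \<open>L\<close> vanishes on constants, the second moment drops out of
  \<open>pair_moment\<close>. The arbitrary reference index \<open>p\<close> lets all fourth moments
  be written in terms of one number.\<close>

lemma fourth_moment_distinct:
  assumes "i \<noteq> j"
  shows "L (\<lambda>x. (x $ i)\<^sup>2 * (x $ j)\<^sup>2) = - L (\<lambda>x. (x $ p) ^ 4) / (real CARD('n) - 1)"
  using pair_moment[OF assms, of 2] second_moment_eq_0[of i] power_moment_eq[of i 4 p] n
  by (simp add: field_simps)

lemma sixth_moment_pair:
  assumes "i \<noteq> j"
  shows "L (\<lambda>x. (x $ i) ^ 4 * (x $ j)\<^sup>2) =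
    (\<rho>2 * L (\<lambda>x. (x $ p) ^ 4) - L (\<lambda>x. (x $ p) ^ 6)) / (real CARD('n) - 1)"
  using pair_moment[OF assms, of 4] power_moment_eq[of i 4 p] power_moment_eq[of i 6 p] n
  by (simp add: field_simps)

text \<open>By \<open>triple_moment\<close> the left side times \<open>n - 2\<close> is a
  combination of the two kinds of pair moments, each already known up to the factor
  \<open>n - 1\<close>; \<open>n \<ge> 3\<close> keeps both factors nonzero.\<close>

lemma sixth_moment_distinct:
  assumes "i \<noteq> j" "i \<noteq> k" "j \<noteq> k"
  shows "L (\<lambda>x. (x $ i)\<^sup>2 * (x $ j)\<^sup>2 * (x $ k)\<^sup>2) =
    (2 * L (\<lambda>x. (x $ p) ^ 6) - 3 * \<rho>2 * L (\<lambda>x. (x $ p) ^ 4)) / ((real CARD('n) - 1) * (real CARD('n) - 2))"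
proof -
  let ?n = "real CARD('n)"
  have "(?n - 1) * (?n - 2) \<noteq> 0"
    using n by simp
  moreover have "(?n - 1) * L (\<lambda>x. (x $ i)\<^sup>2 * (x $ j)\<^sup>2) = - L (\<lambda>x. (x $ p) ^ 4)"
    using fourth_moment_distinct[OF assms(1), of p] n by simp
  moreover have "(?n - 1) * L (\<lambda>x. (x $ i) ^ 4 * (x $ j)\<^sup>2) =
        \<rho>2 * L (\<lambda>x. (x $ p) ^ 4) - L (\<lambda>x. (x $ p) ^ 6)"
      "(?n - 1) * L (\<lambda>x. (x $ j) ^ 4 * (x $ i)\<^sup>2) =
        \<rho>2 * L (\<lambda>x. (x $ p) ^ 4) - L (\<lambda>x. (x $ p) ^ 6)"
    using sixth_moment_pair[OF assms(1), of p] sixth_moment_pair[OF assms(1)[symmetric], of p] n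
    by simp_all
  ultimately show ?thesis
    using triple_moment[OF assms] by (subst nonzero_eq_divide_eq) (simp, algebra)
qed

end

end

text \<open>The order of quantifiers matters: \<open>a\<close>, \<open>b\<close>, \<open>c\<close>
  are chosen before \<open>L\<close> and \<open>\<rho>2\<close>, so they can be pulled out of a
  weighted sum over shells of different radii. The side conditions record which of the three
  quantities occur up to degrees 3 and 5.\<close>

lemma monomial_moment_reduction:
  fixes \<alpha> :: "'n::finite \<Rightarrow> nat" and p :: 'n
  assumes n: "CARD('n) \<ge> 3" and deg: "sum \<alpha> UNIV \<le> 7"
  shows "\<exists>a b c. (sum \<alpha> UNIV \<le> 3 \<longrightarrow> a = 0) \<and> (sum \<alpha> UNIV \<le> 5 \<longrightarrow> b = 0 \<and> c = 0) \<and>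
    (\<forall>L \<rho>2. octahedral_functional L \<rho>2 \<longrightarrow> L (\<lambda>_. 1) = 0 \<longrightarrow>
      L (vec_monomial \<alpha>) = a * L (\<lambda>x. (x $ p) ^ 4) + b * (\<rho>2 * L (\<lambda>x. (x $ p) ^ 4)) + c * L (\<lambda>x. (x $ p) ^ 6))"
    (is "\<exists>a b c. ?P a b c")
proof (cases "\<exists>i. odd (\<alpha> i)")
  case True
  then have "?P 0 0 0"
    by (auto simp: octahedral_functional.odd_monomial_eq_0)
  then show ?thesis
    by blast
next
  case False
  then obtain "is" where len: "2 * length is = sum \<alpha> UNIV"
      and mono: "vec_monomial \<alpha> = (\<lambda>x. prod_list (map (\<lambda>i. (x $ i)\<^sup>2) is))"
    using vec_monomial_even[of \<alpha>] by blast
  let ?n = "real CARD('n)"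
  have pow: "(a\<^sup>2 * a\<^sup>2) = a ^ 4" "a\<^sup>2 * (a\<^sup>2 * b) = a ^ 4 * b" "a\<^sup>2 * a ^ 4 = a ^ 6" for a b :: real
    by (simp_all flip: power_add mult.assoc)
  \<comment> \<open>Twice the length is the degree, which is at most 7, so the length is at most
    3.\<close>
  consider "is = []" | i where "is = [i]" | i j where "is = [i, j]" | i j k where "is = [i, j, k]"
    using len deg by (cases "is" rule: list.exhaust; cases "tl is"; cases "tl (tl is)"; cases "tl (tl (tl is))") auto
  then show ?thesis
  proof cases
    case 1
    then have "?P 0 0 0"
      by (simp add: mono)
    then show ?thesis by blast
  next
    case 2
    then have "?P 0 0 0"
      using n by (simp add: mono octahedral_functional.second_moment_eq_0)
    then show ?thesis by blast
  next
    case (3 i j)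
    show ?thesis
    proof (cases "i = j")
      case True
      then have "?P 1 0 0"
        using 3 len by (auto simp: mono pow intro: octahedral_functional.power_moment_eq)
      then show ?thesis by blast
    next
      case False
      then have "?P (- 1 / (?n - 1)) 0 0"
        using 3 len n by (auto simp: mono octahedral_functional.fourth_moment_distinct[where p = p])
      then show ?thesis by blast
    qed
  next
    case (4 i j k)
    have pair: "L (\<lambda>x. (x $ u) ^ 4 * (x $ v)\<^sup>2) =
        1 / (?n - 1) * (\<rho>2 * L (\<lambda>x. (x $ p) ^ 4)) + - 1 / (?n - 1) * L (\<lambda>x. (x $ p) ^ 6)"
      if "octahedral_functional L \<rho>2" "L (\<lambda>_. 1) = 0" "u \<noteq> v" for L \<rho>2 u v
      using octahedral_functional.sixth_moment_pair[OF that(1) n that(2,3), of p]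
      by (simp add: diff_divide_distrib)
    consider "i = j" "j = k" | "i = j" "j \<noteq> k" | "i = k" "j \<noteq> k" | "j = k" "i \<noteq> k"
      | "i \<noteq> j" "i \<noteq> k" "j \<noteq> k"
      by blast
    then show ?thesis
    proof cases
      case 1
      then have "?P 0 0 1"
        using 4 len by (auto simp: mono pow intro: octahedral_functional.power_moment_eq)
      then show ?thesis by blast
    next
      case 2
      have eq: "vec_monomial \<alpha> = (\<lambda>x. (x $ i) ^ 4 * (x $ k)\<^sup>2)"
        using 2 4 by (simp add: mono pow)
      have "?P 0 (1 / (?n - 1)) (- 1 / (?n - 1))"
        using 4 len pair[of _ _ i k] 2 unfolding eq by auto
      then show ?thesis by blast
    next
      case 3
      have eq: "vec_monomial \<alpha> = (\<lambda>x. (x $ i) ^ 4 * (x $ j)\<^sup>2)"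
        using 3 4 by (simp add: mono mult_ac pow)
      have "?P 0 (1 / (?n - 1)) (- 1 / (?n - 1))"
        using 4 len pair[of _ _ i j] 3 unfolding eq by auto
      then show ?thesis by blast
    next
      case last_pair: 4
      have eq: "vec_monomial \<alpha> = (\<lambda>x. (x $ j) ^ 4 * (x $ i)\<^sup>2)"
        using 4 last_pair by (simp add: mono pow mult.commute)
      have "?P 0 (1 / (?n - 1)) (- 1 / (?n - 1))"
        using 4 len pair[of _ _ j i] last_pair unfolding eq by auto
      then show ?thesis by blast
    next
      case 5
      have eq: "vec_monomial \<alpha> = (\<lambda>x. (x $ i)\<^sup>2 * (x $ j)\<^sup>2 * (x $ k)\<^sup>2)"
        using 4 by (simp add: mono mult.assoc)
      have "?P 0 (- 3 / ((?n - 1) * (?n - 2))) (2 / ((?n - 1) * (?n - 2)))"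
        using 4 len octahedral_functional.sixth_moment_distinct[OF _ n _ 5, of _ _ p]
        unfolding eq by (auto simp: diff_divide_distrib mult.assoc)
      then show ?thesis by blast
    qed
  qed
qed

section \<open>Layers\<close>

lemma finite_Ink: "finite (Ink k :: (real^'n::finite) set)"
proof -
  have "Ink k \<subseteq> vec_lambda ` (UNIV \<rightarrow>\<^sub>E {-1, 0, 1 :: real} :: ('n \<Rightarrow> real) set)"
  proof
    fix x :: "real^'n"
    assume "x \<in> Ink k"
    then show "x \<in> vec_lambda ` (UNIV \<rightarrow>\<^sub>E {-1, 0, 1})"
      by (intro image_eqI[of _ _ "vec_nth x"]) (auto simp: Ink_def)
  qed
  then show ?thesis
    by (rule finite_subset) (intro finite_imageI finite_PiE, auto)
qed

lemma Ink_component_square: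
  fixes x :: "real^'n::finite"
  assumes "x \<in> Ink k"
  shows "(x $ i)\<^sup>2 = (if x $ i \<noteq> 0 then 1 else 0)"
proof -
  have "x $ i \<in> {-1, 0, 1}"
    using assms by (simp add: Ink_def)
  then show ?thesis
    by auto
qed

lemma Ink_sum_squares:
  fixes x :: "real^'n::finite"
  assumes "x \<in> Ink k"
  shows "(\<Sum>i\<in>UNIV. (x $ i)\<^sup>2) = real k"
  using assms by (simp add: Ink_component_square[OF assms] sum.If_cases Ink_def)

lemma norm_Ink:
  fixes x :: "real^'n::finite"
  assumes "x \<in> Ink k"
  shows "norm x = sqrt (real k)"
  using Ink_sum_squares[OF assms] by (simp add: norm_vec_def L2_set_def)

lemma card_Ink_pos:
  assumes "k \<le> CARD('n::finite)"
  shows "card (Ink k :: (real^'n) set) > 0"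
proof -
  obtain S :: "'n set" where "card S = k"
    using obtain_subset_with_card_n[OF assms] by blast
  then have "(\<chi> i. if i \<in> S then 1 else 0) \<in> (Ink k :: (real^'n) set)"
    by (simp add: Ink_def)
  then show ?thesis
    using finite_Ink card_gt_0_iff by blast
qed

lemma signed_permutation_bij_Ink:
  fixes s :: "'n::finite \<Rightarrow> real"
  assumes p: "bij p" and s: "\<And>l. s l \<in> {1, -1}"
  shows "bij_betw (\<lambda>x :: real^'n. \<chi> l. s l * x $ p l) (Ink k) (Ink k)"
proof -
  let ?T = "\<lambda>x :: real^'n. (\<chi> l. s l * x $ p l) :: real^'n"
  have s0: "s l \<noteq> 0" for l
    using s[of l] by auto
  have "inj ?T"
    using orthogonal_transformation_signed_permutation[OF p s] by (rule orthogonal_transformation_inj)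
  then have inj: "inj_on ?T (Ink k)"
    by (rule inj_on_subset) simp
  have "?T ` Ink k \<subseteq> Ink k"
  proof (intro image_subsetI)
    fix x :: "real^'n"
    assume x: "x \<in> Ink k"
    have "bij_betw p {l. x $ p l \<noteq> 0} {l. x $ l \<noteq> 0}"
      using p by (auto simp: bij_betw_def inj_on_def image_iff bij_def)
    then have "card {l. x $ p l \<noteq> 0} = card {l. x $ l \<noteq> 0}"
      by (rule bij_betw_same_card)
    moreover have "s l * x $ p l \<in> {-1, 0, 1}" for l
    proof -
      have "x $ p l \<in> {-1, 0, 1}"
        using x by (simp add: Ink_def)
      then show ?thesis
        using s[of l] by auto
    qed
    ultimately show "?T x \<in> Ink k"
      using x s0 by (simp add: Ink_def)
  qed
  from endo_inj_surj[OF finite_Ink this inj] inj show ?thesis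
    by (simp add: bij_betw_def)
qed

definition layer_sum :: "nat \<Rightarrow> real \<Rightarrow> (real^'n::finite \<Rightarrow> real) \<Rightarrow> real" where
  "layer_sum k \<rho> f = (\<Sum>x\<in>Ink k. f ((\<rho> / sqrt (real k)) *\<^sub>R x))"

lemma octahedral_functional_layer_sum:
  assumes "k > 0"
  shows "octahedral_functional (layer_sum k \<rho> :: (real^'n::finite \<Rightarrow> real) \<Rightarrow> real) (\<rho>\<^sup>2)"
proof
  fix f :: "real^'n \<Rightarrow> real"
  show "layer_sum k \<rho> (\<lambda>x. - f x) = - layer_sum k \<rho> f"
    by (simp add: layer_sum_def sum_negf)
  let ?c = "\<rho> / sqrt (real k)"
  show "layer_sum k \<rho> (\<lambda>x. f (\<chi> l. s l * x $ p l)) = layer_sum k \<rho> f"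
    if "bij p" "\<And>l. s l \<in> {1, -1}" for p :: "'n \<Rightarrow> 'n" and s :: "'n \<Rightarrow> real"
  proof -
    have "(\<chi> l. s l * (?c *\<^sub>R x) $ p l) = ?c *\<^sub>R (\<chi> l. s l * x $ p l)" for x :: "real^'n"
      by (simp add: vec_eq_iff)
    then show ?thesis
      using sum.reindex_bij_betw[OF signed_permutation_bij_Ink[OF that, where k = k], of "\<lambda>x. f (?c *\<^sub>R x)"]
      by (simp add: layer_sum_def)
  qed
  have "(\<Sum>j\<in>UNIV. layer_sum k \<rho> (\<lambda>x. (x $ j)\<^sup>2 * f x)) =
      (\<Sum>x\<in>Ink k. ?c\<^sup>2 * (\<Sum>j\<in>UNIV. (x $ j)\<^sup>2) * f (?c *\<^sub>R x))"
    unfolding layer_sum_def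
    by (subst sum.swap) (simp add: sum_distrib_left sum_distrib_right power_mult_distrib power_divide)
  also have "\<dots> = (\<Sum>x\<in>Ink k. \<rho>\<^sup>2 * f (?c *\<^sub>R x))"
    using assms by (intro sum.cong refl) (simp add: Ink_sum_squares power_divide)
  finally show "(\<Sum>j\<in>UNIV. layer_sum k \<rho> (\<lambda>x. (x $ j)\<^sup>2 * f x)) = \<rho>\<^sup>2 * layer_sum k \<rho> f"
    by (simp add: layer_sum_def sum_distrib_left)
qed

text \<open>A coordinate \<open>y\<close> of a point of the shell is \<open>0\<close> or has
  \<open>y\<^sup>2 = \<rho>\<^sup>2 / k\<close>, so
  \<open>y ^ 4 = \<rho>\<^sup>2 / k * y\<^sup>2\<close>. All even moments of one coordinate thus
  come from the second one.\<close>

lemma layer_sum_power_reduce: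
  fixes i :: "'n::finite"
  shows "layer_sum k \<rho> (\<lambda>x. (x $ i) ^ (a + 4)) = \<rho>\<^sup>2 / real k * layer_sum k \<rho> (\<lambda>x. (x $ i) ^ (a + 2))"
proof -
  define c where "c = \<rho> / sqrt (real k)"
  have c2: "c\<^sup>2 = \<rho>\<^sup>2 / real k"
    by (simp add: c_def power_divide)
  have "((c *\<^sub>R x) $ i) ^ (a + 4) = \<rho>\<^sup>2 / real k * ((c *\<^sub>R x) $ i) ^ (a + 2)"
    if "x \<in> Ink k" for x :: "real^'n"
  proof -
    have "(x $ i) ^ (a + 4) = (x $ i) ^ a * ((x $ i)\<^sup>2)\<^sup>2"
      by (simp add: power_add)
    also have "((x $ i)\<^sup>2)\<^sup>2 = (x $ i)\<^sup>2"
      unfolding Ink_component_square[OF that] by simp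
    also have "(x $ i) ^ a * (x $ i)\<^sup>2 = (x $ i) ^ (a + 2)"
      by (simp only: power_add)
    finally show ?thesis
      by (simp add: power_mult_distrib flip: c2) (simp add: power_add eval_nat_numeral)
  qed
  then show ?thesis
    by (simp add: layer_sum_def sum_distrib_left flip: c_def)
qed

section \<open>Deviation of a shell from its sphere\<close>

definition layer_defect :: "nat \<Rightarrow> real \<Rightarrow> (real^'n::finite \<Rightarrow> real) \<Rightarrow> real" where
  "layer_defect k \<rho> f = layer_sum k \<rho> f - real (card (Ink k :: (real^'n) set)) * sphere_avg f \<rho>"

lemma octahedral_functional_layer_defect:
  assumes "k > 0"
  shows "octahedral_functional (layer_defect k \<rho> :: (real^'n::finite \<Rightarrow> real) \<Rightarrow> real) (\<rho>\<^sup>2)"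
  unfolding layer_defect_def[abs_def]
  by (rule octahedral_functional_diff[OF octahedral_functional_layer_sum[OF assms] octahedral_functional_sphere_avg])

lemma layer_defect_const: "layer_defect k \<rho> (\<lambda>_ :: real^'n::finite. 1) = 0"
  by (simp add: layer_defect_def layer_sum_def sphere_avg_const)

lemma layer_defect_sum:
  fixes f :: "'b \<Rightarrow> real^'n::finite \<Rightarrow> real"
  assumes "finite A" "\<And>a. a \<in> A \<Longrightarrow> continuous_on UNIV (f a)"
  shows "layer_defect k \<rho> (\<lambda>x. \<Sum>a\<in>A. c a * f a x) = (\<Sum>a\<in>A. c a * layer_defect k \<rho> (f a))"
proof -
  have "sphere_avg (\<lambda>x. \<Sum>a\<in>A. c a * f a x) \<rho> = (\<Sum>a\<in>A. c a * sphere_avg (f a) \<rho>)"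
    using assms by (subst sphere_avg_sum) (auto intro!: continuous_intros simp: sphere_avg_cmult)
  moreover have "layer_sum k \<rho> (\<lambda>x. \<Sum>a\<in>A. c a * f a x) = (\<Sum>a\<in>A. c a * layer_sum k \<rho> (f a))"
    unfolding layer_sum_def by (subst sum.swap) (simp add: sum_distrib_left)
  ultimately show ?thesis
    by (simp add: layer_defect_def sum_subtractf right_diff_distrib sum_distrib_left mult_ac)
qed

lemma layer_sum_moments:
  fixes i :: "'n::finite"
  assumes k: "k > 0"
  defines "N \<equiv> real (card (Ink k :: (real^'n) set))"
  shows "layer_sum k \<rho> (\<lambda>x. (x $ i) ^ 4) = N * \<rho> ^ 4 / (real k * real CARD('n))"
    and "layer_sum k \<rho> (\<lambda>x. (x $ i) ^ 6) = N * \<rho> ^ 6 / ((real k)\<^sup>2 * real CARD('n))"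
proof -
  interpret octahedral_functional "layer_sum k \<rho> :: (real^'n \<Rightarrow> real) \<Rightarrow> real" "\<rho>\<^sup>2"
    by (rule octahedral_functional_layer_sum[OF k])
  have "layer_sum k \<rho> (\<lambda>_ :: real^'n. 1) = N"
    by (simp add: layer_sum_def N_def)
  then have "layer_sum k \<rho> (\<lambda>x. (x $ i)\<^sup>2) = \<rho>\<^sup>2 * N / real CARD('n)"
    using second_moment[of i] by (simp add: field_simps)
  then show 4: "layer_sum k \<rho> (\<lambda>x. (x $ i) ^ 4) = N * \<rho> ^ 4 / (real k * real CARD('n))"
    using layer_sum_power_reduce[of k \<rho> i 0] by (simp add: power4_eq_xxxx power2_eq_square)
  show "layer_sum k \<rho> (\<lambda>x. (x $ i) ^ 6) = N * \<rho> ^ 6 / ((real k)\<^sup>2 * real CARD('n))"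
    using layer_sum_power_reduce[of k \<rho> i 2] 4 by (simp add: power2_eq_square eval_nat_numeral mult_ac)
qed

text \<open>Supplies the second axis for the plane rotations behind the sphere moments, and the
  second variable of the test monomials.\<close>

lemma exists_other_index:
  assumes "CARD('n::finite) \<ge> 3"
  shows "\<exists>j :: 'n. i \<noteq> j"
proof (rule ccontr)
  assume "\<not> ?thesis"
  then have "UNIV = {i}"
    by auto
  then have "CARD('n) = 1"
    by (metis card_1_singleton_iff One_nat_def)
  then show False
    using assms by simp
qed

text \<open>The factor \<open>n + 2 - 3 * k\<close> is the numerator of
  \<open>1 / k - 3 / (n + 2)\<close>, shell moment minus sphere moment. Its sign change is the
  origin of the threshold \<open>(n + 2) / 3\<close>.\<close>

lemma layer_defect_fourth:
  fixes i :: "'n::finite"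
  assumes k: "k > 0" and n: "CARD('n) \<ge> 3"
  shows "layer_defect k \<rho> (\<lambda>x. (x $ i) ^ 4) = real (card (Ink k :: (real^'n) set)) * \<rho> ^ 4 *
    (real CARD('n) + 2 - 3 * real k) / (real k * real CARD('n) * (real CARD('n) + 2))"
proof -
  obtain j :: 'n where "i \<noteq> j"
    using exists_other_index[OF n] by blast
  moreover have "real CARD('n) > 0" "real k > 0"
    using k by simp_all
  ultimately show ?thesis
    unfolding layer_defect_def layer_sum_moments[OF k]
    by (simp only: sphere_avg_fourth_moment)
       (simp add: divide_simps, simp add: algebra_simps)
qed

text \<open>Here the difference is \<open>1 / k^2 - 15 / ((n + 2) * (n + 4))\<close>.\<close>

lemma layer_defect_sixth:
  fixes i :: "'n::finite"
  assumes k: "k > 0" and n: "CARD('n) \<ge> 3"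
  shows "layer_defect k \<rho> (\<lambda>x. (x $ i) ^ 6) = real (card (Ink k :: (real^'n) set)) * \<rho> ^ 6 *
    ((real CARD('n) + 2) * (real CARD('n) + 4) - 15 * (real k)\<^sup>2) /
    ((real k)\<^sup>2 * real CARD('n) * (real CARD('n) + 2) * (real CARD('n) + 4))"
proof -
  obtain j :: 'n where "i \<noteq> j"
    using exists_other_index[OF n] by blast
  moreover have "real CARD('n) > 0" "real k > 0"
    using k by simp_all
  ultimately show ?thesis
    unfolding layer_defect_def layer_sum_moments[OF k]
    by (simp only: sphere_avg_sixth_moment)
       (simp add: divide_simps, simp add: algebra_simps)
qed

text \<open>The shell sums agree, because nonzero coordinates of a point have equal squares. The
  sphere average enters the defect negatively, which reverses
  \<open>sphere_avg_eighth_moment_less\<close>.\<close>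

lemma layer_defect_eighth_less:
  fixes i j :: "'n::finite"
  assumes "k \<le> CARD('n)" "\<rho> > 0" "i \<noteq> j"
  shows "layer_defect k \<rho> (\<lambda>x. (x $ i) ^ 6 * (x $ j) ^ 2) < layer_defect k \<rho> (\<lambda>x. (x $ i) ^ 4 * (x $ j) ^ 4)"
proof -
  let ?c = "\<rho> / sqrt (real k)"
  have "((?c *\<^sub>R x) $ i) ^ 6 * ((?c *\<^sub>R x) $ j) ^ 2 = ((?c *\<^sub>R x) $ i) ^ 4 * ((?c *\<^sub>R x) $ j) ^ 4"
    if x: "x \<in> Ink k" for x :: "real^'n"
  proof -
    have "((c * a) ^ 6 * (c * b) ^ 2 = (c * a) ^ 4 * (c * b) ^ 4)"
      if "a \<in> {-1, 0, 1}" "b \<in> {-1, 0, 1}" for a b c :: real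
      using that by auto
    then show ?thesis
      using x by (simp only: Ink_def mem_Collect_eq vector_scaleR_component real_scaleR_def)
  qed
  then have "layer_sum k \<rho> (\<lambda>x. (x $ i) ^ 6 * (x $ j) ^ 2) = layer_sum k \<rho> (\<lambda>x. (x $ i) ^ 4 * (x $ j) ^ 4)"
    unfolding layer_sum_def by (intro sum.cong refl) blast
  then show ?thesis
    using sphere_avg_eighth_moment_less[OF assms(3,2)] card_Ink_pos[OF assms(1)]
    by (simp add: layer_defect_def)
qed

section \<open>Designs in terms of moments\<close>

text \<open>The number of nonzero coordinates survives scaling by a nonzero factor, so it separates
  the shells even when their radii coincide.\<close>

lemma sum_XJ:
  fixes h :: "real^'n::finite \<Rightarrow> real"
  assumes "admissible CARD('n) J r"
  shows "sum h (XJ J r) = (\<Sum>k\<in>J. \<Sum>x\<in>Ink k. h ((r k / sqrt (real k)) *\<^sub>R x))"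
proof -
  have J: "finite J" "\<And>k. k \<in> J \<Longrightarrow> r k / sqrt (real k) \<noteq> 0"
    using assms finite_subset[of J "{1..CARD('n)}"] by (force simp: admissible_def)+
  let ?S = "\<lambda>k. (\<lambda>x. (r k / sqrt (real k)) *\<^sub>R x) ` (Ink k :: (real^'n) set)"
  have card: "card {i. x $ i \<noteq> 0} = k" if k: "k \<in> J" and x: "x \<in> ?S k" for x k
  proof -
    obtain c y where "c \<noteq> 0" "x = c *\<^sub>R y" "y \<in> Ink k"
      using x J(2)[OF k] by blast
    then show ?thesis
      by (simp add: Ink_def)
  qed
  have "sum h (XJ J r) = (\<Sum>k\<in>J. sum h (?S k))"
    unfolding XJ_def
  proof (rule sum.UNION_disjoint)
    show "\<forall>k\<in>J. \<forall>l\<in>J. k \<noteq> l \<longrightarrow> ?S k \<inter> ?S l = {}"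
    proof (intro ballI impI equals0I)
      fix k l x
      assume "k \<in> J" "l \<in> J" "k \<noteq> l" "x \<in> ?S k \<inter> ?S l"
      then show False
        using card[of k x] card[of l x] by simp
    qed
  qed (use J(1) in \<open>auto simp: finite_Ink\<close>)
  also have "\<dots> = (\<Sum>k\<in>J. \<Sum>x\<in>Ink k. h ((r k / sqrt (real k)) *\<^sub>R x))"
  proof (rule sum.cong[OF refl])
    fix k
    assume "k \<in> J"
    then have "inj_on (\<lambda>x. (r k / sqrt (real k)) *\<^sub>R x) (Ink k :: (real^'n) set)"
      using J(2) by (auto simp: inj_on_def)
    then show "sum h (?S k) = (\<Sum>x\<in>Ink k. h ((r k / sqrt (real k)) *\<^sub>R x))"
      by (simp add: sum.reindex)
  qed
  finally show ?thesis .
qed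

lemma finite_XJ: "finite J \<Longrightarrow> finite (XJ J r :: (real^'n::finite) set)"
  by (simp add: XJ_def finite_Ink)

lemma sum_layer_weight:
  assumes "finite X"
  shows "(\<Sum>\<rho>\<in>norm ` X. layer_weight X w \<rho> * A \<rho>) = (\<Sum>x\<in>X. w x * A (norm x))"
proof -
  have "{x \<in> X. norm x = \<rho>} = X \<inter> sphere 0 \<rho>" for \<rho>
    by auto
  then show ?thesis
    using sum.image_gen[OF assms, of "\<lambda>x. w x * A (norm x)" norm]
    by (auto simp: layer_weight_def sum_distrib_right intro!: sum.cong)
qed

text \<open>A layer collects all shells of one radius. Writing the layer side as a sum over points
  undoes this grouping, and each shell is then compared with the average over its own
  sphere.\<close>

lemma design_equation_iff_defect:
  fixes f :: "real^'n::finite \<Rightarrow> real"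
  assumes adm: "admissible CARD('n) J r"
  defines "X \<equiv> XJ J r"
  shows "(\<Sum>\<rho>\<in>norm ` X. layer_weight X (layer_wfun wk) \<rho> * sphere_avg f \<rho>) = (\<Sum>x\<in>X. layer_wfun wk x * f x)
    \<longleftrightarrow> (\<Sum>k\<in>J. wk k * layer_defect k (r k) f) = 0"
proof -
  have J: "finite J" "\<And>k. k \<in> J \<Longrightarrow> r k > 0 \<and> k > 0"
    using adm finite_subset[of J "{1..CARD('n)}"] by (force simp: admissible_def)+
  have nz: "layer_wfun wk ((r k / sqrt (real k)) *\<^sub>R x) = wk k"
      "norm ((r k / sqrt (real k)) *\<^sub>R x) = r k"
    if "k \<in> J" "x \<in> Ink k" for k and x :: "real^'n"
  proof -
    show "norm ((r k / sqrt (real k)) *\<^sub>R x) = r k"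
      using J(2)[OF that(1)] by (simp add: norm_Ink[OF that(2)])
    show "layer_wfun wk ((r k / sqrt (real k)) *\<^sub>R x) = wk k"
      using that(2) J(2)[OF that(1)] by (simp add: layer_wfun_def Ink_def)
  qed
  have "(\<Sum>\<rho>\<in>norm ` X. layer_weight X (layer_wfun wk) \<rho> * sphere_avg f \<rho>) =
      (\<Sum>x\<in>X. layer_wfun wk x * sphere_avg f (norm x))"
    unfolding X_def by (rule sum_layer_weight[OF finite_XJ[OF J(1)]])
  also have "\<dots> = (\<Sum>k\<in>J. \<Sum>x\<in>(Ink k :: (real^'n) set). wk k * sphere_avg f (r k))"
    unfolding X_def sum_XJ[OF adm] by (intro sum.cong refl) (simp only: nz)
  finally have 1: "(\<Sum>\<rho>\<in>norm ` X. layer_weight X (layer_wfun wk) \<rho> * sphere_avg f \<rho>) =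
      (\<Sum>k\<in>J. wk k * (real (card (Ink k :: (real^'n) set)) * sphere_avg f (r k)))"
    by (simp add: mult_ac)
  have 2: "(\<Sum>x\<in>X. layer_wfun wk x * f x) = (\<Sum>k\<in>J. wk k * layer_sum k (r k) f)"
    unfolding X_def sum_XJ[OF adm] layer_sum_def sum_distrib_left
    by (intro sum.cong refl) (simp only: nz)
  show ?thesis
    unfolding 1 2 by (auto simp: layer_defect_def right_diff_distrib sum_subtractf)
qed

lemma poly_deg_le_vec_monomial:
  assumes "sum \<alpha> UNIV \<le> t"
  shows "poly_deg_le t (vec_monomial \<alpha>)"
  unfolding poly_deg_le_def
  using assms by (intro exI[of _ "{\<alpha>}"] exI[of _ "\<lambda>_. 1"]) (auto simp: vec_monomial_def)

lemma euclidean_design_iff_monomials: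
  assumes adm: "admissible CARD('n::finite) J r"
  shows "euclidean_design (XJ J r :: (real^'n) set) (layer_wfun wk) t \<longleftrightarrow>
    (\<forall>\<alpha> :: 'n \<Rightarrow> nat. sum \<alpha> UNIV \<le> t \<longrightarrow> (\<Sum>k\<in>J. wk k * layer_defect k (r k) (vec_monomial \<alpha>)) = 0)"
  unfolding euclidean_design_def design_equation_iff_defect[OF adm]
proof (intro iffI allI impI)
  fix f :: "real^'n \<Rightarrow> real"
  assume *: "\<forall>\<alpha> :: 'n \<Rightarrow> nat. sum \<alpha> UNIV \<le> t \<longrightarrow>
      (\<Sum>k\<in>J. wk k * layer_defect k (r k) (vec_monomial \<alpha>)) = 0"
  assume "poly_deg_le t f"
  then obtain A c where A: "finite A" "\<forall>\<alpha>\<in>A. sum \<alpha> UNIV \<le> t"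
      and f: "f = (\<lambda>x. \<Sum>\<alpha>\<in>A. c \<alpha> * vec_monomial \<alpha> x)"
    unfolding poly_deg_le_def vec_monomial_def[symmetric] by blast
  have "(\<Sum>k\<in>J. wk k * layer_defect k (r k) f) =
      (\<Sum>k\<in>J. \<Sum>\<alpha>\<in>A. c \<alpha> * (wk k * layer_defect k (r k) (vec_monomial \<alpha>)))"
    unfolding f layer_defect_sum[OF A(1) continuous_on_vec_monomial]
    by (simp add: sum_distrib_left mult_ac)
  also have "\<dots> = (\<Sum>\<alpha>\<in>A. c \<alpha> * (\<Sum>k\<in>J. wk k * layer_defect k (r k) (vec_monomial \<alpha>)))"
    by (subst sum.swap) (simp add: sum_distrib_left)
  also have "\<dots> = 0"
    using * A(2) by simp
  finally show "(\<Sum>k\<in>J. wk k * layer_defect k (r k) f) = 0" .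
qed (simp add: poly_deg_le_vec_monomial)

lemma poly_deg_le_mono: "poly_deg_le s f \<Longrightarrow> s \<le> t \<Longrightarrow> poly_deg_le t f"
  unfolding poly_deg_le_def by (blast intro: order_trans)

lemma euclidean_design_antimono:
  assumes "euclidean_design X w t" "s \<le> t"
  shows "euclidean_design X w s"
  using assms unfolding euclidean_design_def by (metis poly_deg_le_mono)

lemma vec_monomial_pair:
  fixes i j :: "'n::finite" and a b :: nat
  assumes "i \<noteq> j"
  defines "\<alpha> \<equiv> (\<lambda>l. if l = i then a else if l = j then b else 0)"
  shows "vec_monomial \<alpha> = (\<lambda>x. (x $ i) ^ a * (x $ j) ^ b)" "sum \<alpha> UNIV = a + b"
proof -
  have "(\<Prod>l\<in>UNIV - {i} - {j}. (x $ l) ^ \<alpha> l) = 1" for x :: "real^'n"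
    by (rule prod.neutral) (auto simp: \<alpha>_def)
  then show "vec_monomial \<alpha> = (\<lambda>x. (x $ i) ^ a * (x $ j) ^ b)"
    using assms(1)
    by (simp add: fun_eq_iff vec_monomial_split[of _ _ i] prod.remove[of "UNIV - {i}" j])
       (simp add: \<alpha>_def)
  have "(\<Sum>l\<in>UNIV - {i} - {j}. \<alpha> l) = 0"
    by (rule sum.neutral) (auto simp: \<alpha>_def)
  then show "sum \<alpha> UNIV = a + b"
    using assms(1) by (simp add: sum.remove[of UNIV i] sum.remove[of "UNIV - {i}" j]) (simp add: \<alpha>_def)
qed

section \<open>Designs of degree 5, 7 and 8, and the strength\<close>

context
  fixes J :: "nat set" and r wk :: "nat \<Rightarrow> real" and p :: "'n::finite"
  assumes adm: "admissible CARD('n) J r" and n: "CARD('n) \<ge> 3"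
begin

private lemma J_pos: "k \<in> J \<Longrightarrow> k > 0" "k \<in> J \<Longrightarrow> r k > 0" "k \<in> J \<Longrightarrow> k \<le> CARD('n)"
  using adm by (force simp: admissible_def)+

private abbreviation D4 :: "nat \<Rightarrow> real" where
  "D4 k \<equiv> layer_defect k (r k) (\<lambda>x :: real^'n. (x $ p) ^ 4)"

private abbreviation D6 :: "nat \<Rightarrow> real" where
  "D6 k \<equiv> layer_defect k (r k) (\<lambda>x :: real^'n. (x $ p) ^ 6)"

private lemma monomial_defect:
  assumes "sum \<alpha> UNIV \<le> 7"
  shows "\<exists>a b c. (sum \<alpha> UNIV \<le> 3 \<longrightarrow> a = 0) \<and> (sum \<alpha> UNIV \<le> 5 \<longrightarrow> b = 0 \<and> c = 0) \<and>
    (\<Sum>k\<in>J. wk k * layer_defect k (r k) (vec_monomial \<alpha> :: real^'n \<Rightarrow> real)) =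
      a * (\<Sum>k\<in>J. wk k * D4 k) + b * (\<Sum>k\<in>J. wk k * ((r k)\<^sup>2 * D4 k)) + c * (\<Sum>k\<in>J. wk k * D6 k)"
proof -
  obtain a b c where abc: "sum \<alpha> UNIV \<le> 3 \<longrightarrow> a = 0" "sum \<alpha> UNIV \<le> 5 \<longrightarrow> b = 0 \<and> c = 0"
    and red: "\<And>L \<rho>2. octahedral_functional L \<rho>2 \<Longrightarrow> L (\<lambda>_. 1) = 0 \<Longrightarrow>
      L (vec_monomial \<alpha>) = a * L (\<lambda>x. (x $ p) ^ 4) + b * (\<rho>2 * L (\<lambda>x. (x $ p) ^ 4)) + c * L (\<lambda>x. (x $ p) ^ 6)"
    using monomial_moment_reduction[OF n assms, of p] by blast
  have "wk k * layer_defect k (r k) (vec_monomial \<alpha> :: real^'n \<Rightarrow> real) =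
      a * (wk k * D4 k) + b * (wk k * ((r k)\<^sup>2 * D4 k)) + c * (wk k * D6 k)" if "k \<in> J" for k
    using red[OF octahedral_functional_layer_defect[OF J_pos(1)[OF that]] layer_defect_const]
    by (simp add: algebra_simps)
  then have "(\<Sum>k\<in>J. wk k * layer_defect k (r k) (vec_monomial \<alpha> :: real^'n \<Rightarrow> real)) =
      a * (\<Sum>k\<in>J. wk k * D4 k) + b * (\<Sum>k\<in>J. wk k * ((r k)\<^sup>2 * D4 k)) + c * (\<Sum>k\<in>J. wk k * D6 k)"
    by (simp add: sum.distrib sum_distrib_left)
  with abc show ?thesis
    by blast
qed

lemma euclidean_design_3: "euclidean_design (XJ J r :: (real^'n) set) (layer_wfun wk) 3"
  unfolding euclidean_design_iff_monomials[OF adm]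
proof (intro allI impI)
  fix \<alpha> :: "'n \<Rightarrow> nat"
  assume "sum \<alpha> UNIV \<le> 3"
  then show "(\<Sum>k\<in>J. wk k * layer_defect k (r k) (vec_monomial \<alpha>)) = 0"
    using monomial_defect[of \<alpha>] by auto
qed

text \<open>Degree 5 adds only monomials with an odd exponent, so one criterion serves
  \<open>t = 4\<close> and \<open>t = 5\<close>. This is what later excludes strength 4.\<close>

lemma euclidean_design_5_iff_defect:
  assumes t: "4 \<le> t" "t \<le> 5"
  shows "euclidean_design (XJ J r :: (real^'n) set) (layer_wfun wk) t \<longleftrightarrow> (\<Sum>k\<in>J. wk k * D4 k) = 0"
  unfolding euclidean_design_iff_monomials[OF adm]
proof (intro iffI allI impI)
  obtain j :: 'n where j: "p \<noteq> j"
    using exists_other_index[OF n] by blast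
  show "(\<Sum>k\<in>J. wk k * D4 k) = 0"
    if "\<forall>\<alpha> :: 'n \<Rightarrow> nat. sum \<alpha> UNIV \<le> t \<longrightarrow> (\<Sum>k\<in>J. wk k * layer_defect k (r k) (vec_monomial \<alpha>)) = 0"
    \<comment> \<open>The exponent 0 at \<open>j\<close> brings the pure power of
      \<open>x\<^sub>p\<close> into the shape of \<open>vec_monomial_pair\<close>.\<close>
    using that[rule_format, of "\<lambda>l. if l = p then 4 else if l = j then 0 else 0"] t
    unfolding vec_monomial_pair[OF j] by simp
next
  fix \<alpha> :: "'n \<Rightarrow> nat"
  assume "(\<Sum>k\<in>J. wk k * D4 k) = 0" "sum \<alpha> UNIV \<le> t"
  then show "(\<Sum>k\<in>J. wk k * layer_defect k (r k) (vec_monomial \<alpha>)) = 0"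
    using monomial_defect[of \<alpha>] t by auto
qed

lemma euclidean_design_7_iff_defect:
  assumes t: "6 \<le> t" "t \<le> 7"
  shows "euclidean_design (XJ J r :: (real^'n) set) (layer_wfun wk) t \<longleftrightarrow>
    (\<Sum>k\<in>J. wk k * D4 k) = 0 \<and> (\<Sum>k\<in>J. wk k * ((r k)\<^sup>2 * D4 k)) = 0 \<and> (\<Sum>k\<in>J. wk k * D6 k) = 0"
  unfolding euclidean_design_iff_monomials[OF adm]
proof (intro iffI allI impI)
  obtain j :: 'n where j: "p \<noteq> j"
    using exists_other_index[OF n] by blast
  assume *: "\<forall>\<alpha> :: 'n \<Rightarrow> nat. sum \<alpha> UNIV \<le> t \<longrightarrow>
    (\<Sum>k\<in>J. wk k * layer_defect k (r k) (vec_monomial \<alpha>)) = 0"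
  have 4: "(\<Sum>k\<in>J. wk k * D4 k) = 0"
    using *[rule_format, of "\<lambda>l. if l = p then 4 else if l = j then 0 else 0"] t
    unfolding vec_monomial_pair[OF j] by simp
  have 6: "(\<Sum>k\<in>J. wk k * D6 k) = 0"
    using *[rule_format, of "\<lambda>l. if l = p then 6 else if l = j then 0 else 0"] t
    unfolding vec_monomial_pair[OF j] by simp
  have "(\<Sum>k\<in>J. wk k * layer_defect k (r k) (\<lambda>x :: real^'n. (x $ p) ^ 4 * (x $ j)\<^sup>2)) = 0"
    using *[rule_format, of "\<lambda>l. if l = p then 4 else if l = j then 2 else 0"] t
    unfolding vec_monomial_pair[OF j] by simp
  \<comment> \<open>The equation containing \<open>(r k)\<^sup>2\<close> is not the test of a single
    monomial. Shell by shell, \<open>pair_moment\<close> expresses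
    \<open>(r k)\<^sup>2 * D4 k\<close> by the defects of
    \<open>x\<^sub>p ^ 4 * x\<^sub>j\<^sup>2\<close> and \<open>x\<^sub>p ^ 6\<close>, with
    coefficients independent of \<open>k\<close>.\<close>
  moreover have "wk k * ((r k)\<^sup>2 * D4 k) = (real CARD('n) - 1) *
      (wk k * layer_defect k (r k) (\<lambda>x :: real^'n. (x $ p) ^ 4 * (x $ j)\<^sup>2)) + wk k * D6 k" if "k \<in> J" for k
  proof -
    note octahedral_functional.pair_moment[OF octahedral_functional_layer_defect[OF J_pos(1)[OF that]] j,
        where a = 4 and ?\<rho>1 = "r k"]
    then have "(r k)\<^sup>2 * D4 k = (real CARD('n) - 1) *
      layer_defect k (r k) (\<lambda>x :: real^'n. (x $ p) ^ 4 * (x $ j)\<^sup>2) + D6 k"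
      by simp
    then show ?thesis
      by (simp only: distrib_left mult.left_commute)
  qed
  then have "(\<Sum>k\<in>J. wk k * ((r k)\<^sup>2 * D4 k)) = (real CARD('n) - 1) *
      (\<Sum>k\<in>J. wk k * layer_defect k (r k) (\<lambda>x :: real^'n. (x $ p) ^ 4 * (x $ j)\<^sup>2)) + (\<Sum>k\<in>J. wk k * D6 k)"
    by (simp add: sum.distrib sum_distrib_left)
  ultimately show "(\<Sum>k\<in>J. wk k * D4 k) = 0 \<and> (\<Sum>k\<in>J. wk k * ((r k)\<^sup>2 * D4 k)) = 0 \<and> (\<Sum>k\<in>J. wk k * D6 k) = 0"
    using 4 6 by simp
next
  fix \<alpha> :: "'n \<Rightarrow> nat"
  assume "(\<Sum>k\<in>J. wk k * D4 k) = 0 \<and> (\<Sum>k\<in>J. wk k * ((r k)\<^sup>2 * D4 k)) = 0 \<and> (\<Sum>k\<in>J. wk k * D6 k) = 0"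
    "sum \<alpha> UNIV \<le> t"
  then show "(\<Sum>k\<in>J. wk k * layer_defect k (r k) (vec_monomial \<alpha>)) = 0"
    using monomial_defect[of \<alpha>] t by auto
qed

lemma not_euclidean_design_8:
  assumes "pos_weights J wk"
  shows "\<not> euclidean_design (XJ J r :: (real^'n) set) (layer_wfun wk) 8"
proof
  assume "euclidean_design (XJ J r :: (real^'n) set) (layer_wfun wk) 8"
  note * = this[unfolded euclidean_design_iff_monomials[OF adm], rule_format]
  obtain j :: 'n where j: "p \<noteq> j"
    using exists_other_index[OF n] by blast
  have "(\<Sum>k\<in>J. wk k * layer_defect k (r k) (\<lambda>x :: real^'n. (x $ p) ^ 6 * (x $ j) ^ 2)) <
      (\<Sum>k\<in>J. wk k * layer_defect k (r k) (\<lambda>x :: real^'n. (x $ p) ^ 4 * (x $ j) ^ 4))"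
    using adm assms
    by (intro sum_strict_mono mult_strict_left_mono layer_defect_eighth_less[OF _ _ j] J_pos)
       (auto simp: admissible_def pos_weights_def intro: finite_subset)
  then show False
    using *[of "\<lambda>l. if l = p then 6 else if l = j then 2 else 0"]
      *[of "\<lambda>l. if l = p then 4 else if l = j then 4 else 0"]
    unfolding vec_monomial_pair[OF j] by simp
qed

text \<open>The bound 7 makes \<open>GREATEST\<close> attained, degree 3 always holds, and the
  values 4 and 6 drop out because the criteria for 4 and 5, and those for 6 and 7, coincide.\<close>

lemma design_strength_cases:
  assumes "pos_weights J wk"
  shows "design_strength (XJ J r :: (real^'n) set) (layer_wfun wk) \<in> {3, 5, 7}"
proof -
  let ?D = "euclidean_design (XJ J r :: (real^'n) set) (layer_wfun wk)"
  have le: "t \<le> 7" if "?D t" for t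
    using not_euclidean_design_8[OF assms] euclidean_design_antimono[OF that, of 8] by force
  define d where "d = design_strength (XJ J r :: (real^'n) set) (layer_wfun wk)"
  have strength: "?D d"
    unfolding d_def design_strength_def
    by (rule GreatestI_nat[where P = ?D, OF euclidean_design_3]) (rule le)
  have greatest: "t \<le> d" if "?D t" for t
    unfolding d_def design_strength_def
    by (rule Greatest_le_nat[where P = ?D, OF that]) (rule le)
  have up: "?D 4 \<Longrightarrow> ?D 5" "?D 6 \<Longrightarrow> ?D 7"
    by (simp_all add: euclidean_design_5_iff_defect euclidean_design_7_iff_defect)
  have "d \<noteq> 4" "d \<noteq> 6"
    using strength up greatest[of 5] greatest[of 7] by auto
  then show ?thesis
    unfolding d_def[symmetric] using greatest[OF euclidean_design_3] le[OF strength] by auto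
qed

end

section \<open>The linear systems for the weights\<close>

text \<open>What \<open>layer_defect_fourth\<close> leaves of the shell after the factor
  \<open>r k ^ 6 / k^2\<close> has moved into the weight; the leading \<open>k\<close> compensates
  \<open>1 / k^2\<close> against the \<open>1 / k\<close> of degree 4.\<close>

definition fourth_coeff :: "nat \<Rightarrow> nat \<Rightarrow> real" where
  "fourth_coeff n k = real k * (real n + 2 - 3 * real k)"

definition sixth_coeff :: "nat \<Rightarrow> nat \<Rightarrow> real" where
  "sixth_coeff n k = (real n + 2) * (real n + 4) - 15 * (real k)\<^sup>2"

text \<open>The rescaled weight \<open>V\<close> is the normalisation in which both degree 6
  equations contain no radius, and the degree 4 equation contains only
  \<open>1 / (r k)\<^sup>2\<close>.\<close>

lemma design_iff_coeffs:
  fixes J :: "nat set" and r wk V :: "nat \<Rightarrow> real"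
  assumes adm: "admissible CARD('n::finite) J r" and n: "CARD('n) \<ge> 3"
    and V: "\<And>k. k \<in> J \<Longrightarrow> V k = wk k * real (card (Ink k :: (real^'n) set)) * r k ^ 6 / (real k)\<^sup>2"
  shows "euclidean_design (XJ J r :: (real^'n) set) (layer_wfun wk) 5 \<longleftrightarrow>
      (\<Sum>k\<in>J. V k * fourth_coeff CARD('n) k / (r k)\<^sup>2) = 0"
    and "euclidean_design (XJ J r :: (real^'n) set) (layer_wfun wk) 7 \<longleftrightarrow>
      (\<Sum>k\<in>J. V k * fourth_coeff CARD('n) k / (r k)\<^sup>2) = 0 \<and>
      (\<Sum>k\<in>J. V k * fourth_coeff CARD('n) k) = 0 \<and> (\<Sum>k\<in>J. V k * sixth_coeff CARD('n) k) = 0"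
proof -
  fix p :: 'n
  let ?n = "real CARD('n)"
  let ?D4 = "\<lambda>k. layer_defect k (r k) (\<lambda>x :: real^'n. (x $ p) ^ 4)"
  let ?D6 = "\<lambda>k. layer_defect k (r k) (\<lambda>x :: real^'n. (x $ p) ^ 6)"
  have pos: "k > 0" "r k > 0" if "k \<in> J" for k
    using adm that by (force simp: admissible_def)+
  have D4: "wk k * ?D4 k = V k * fourth_coeff CARD('n) k / (r k)\<^sup>2 / (?n * (?n + 2))"
    if "k \<in> J" for k
    using pos[OF that] unfolding layer_defect_fourth[OF pos(1)[OF that] n] V[OF that] fourth_coeff_def
    by (simp add: power2_eq_square eval_nat_numeral)
  have D4': "wk k * ((r k)\<^sup>2 * ?D4 k) = V k * fourth_coeff CARD('n) k / (?n * (?n + 2))"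
    if "k \<in> J" for k
    using pos[OF that] unfolding mult.left_commute[of "wk k"] D4[OF that] by simp
  have D6: "wk k * ?D6 k = V k * sixth_coeff CARD('n) k / (?n * (?n + 2) * (?n + 4))"
    if "k \<in> J" for k
    using pos[OF that] unfolding layer_defect_sixth[OF pos(1)[OF that] n] V[OF that] sixth_coeff_def
    by (simp add: mult_ac)
  have sums: "(\<Sum>k\<in>J. wk k * ?D4 k) = (\<Sum>k\<in>J. V k * fourth_coeff CARD('n) k / (r k)\<^sup>2) / (?n * (?n + 2))"
    "(\<Sum>k\<in>J. wk k * ((r k)\<^sup>2 * ?D4 k)) = (\<Sum>k\<in>J. V k * fourth_coeff CARD('n) k) / (?n * (?n + 2))"
    "(\<Sum>k\<in>J. wk k * ?D6 k) = (\<Sum>k\<in>J. V k * sixth_coeff CARD('n) k) / (?n * (?n + 2) * (?n + 4))"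
    unfolding sum_divide_distrib by (intro sum.cong refl D4 D4' D6; assumption)+
  have "?n * (?n + 2) \<noteq> 0" "?n * (?n + 2) * (?n + 4) \<noteq> 0"
    using n by (simp_all add: add_eq_0_iff)
  then show "euclidean_design (XJ J r :: (real^'n) set) (layer_wfun wk) 5 \<longleftrightarrow>
      (\<Sum>k\<in>J. V k * fourth_coeff CARD('n) k / (r k)\<^sup>2) = 0"
    "euclidean_design (XJ J r :: (real^'n) set) (layer_wfun wk) 7 \<longleftrightarrow>
      (\<Sum>k\<in>J. V k * fourth_coeff CARD('n) k / (r k)\<^sup>2) = 0 \<and>
      (\<Sum>k\<in>J. V k * fourth_coeff CARD('n) k) = 0 \<and> (\<Sum>k\<in>J. V k * sixth_coeff CARD('n) k) = 0"
    using euclidean_design_5_iff_defect[OF adm n, of 5 wk p] euclidean_design_7_iff_defect[OF adm n, of 7 wk p]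
    unfolding sums by (simp_all only: divide_eq_0_iff simp_thms)
qed

text \<open>On \<open>J\<close> the rescaling factor is positive, so positive \<open>wk\<close> and
  positive \<open>V\<close> correspond to each other in both directions.\<close>

lemma ex_design_iff_ex_coeffs:
  fixes J :: "nat set" and r :: "nat \<Rightarrow> real"
  assumes adm: "admissible CARD('n::finite) J r" and n: "CARD('n) \<ge> 3"
  shows "(\<exists>wk. pos_weights J wk \<and> euclidean_design (XJ J r :: (real^'n) set) (layer_wfun wk) 5) \<longleftrightarrow>
      (\<exists>V. (\<forall>k\<in>J. V k > 0) \<and> (\<Sum>k\<in>J. V k * fourth_coeff CARD('n) k / (r k)\<^sup>2) = 0)"
    (is "(\<exists>wk. _ \<and> ?D5 wk) \<longleftrightarrow> (\<exists>V. _ \<and> ?E5 V)")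
    and "(\<exists>wk. pos_weights J wk \<and> euclidean_design (XJ J r :: (real^'n) set) (layer_wfun wk) 7) \<longleftrightarrow>
      (\<exists>V. (\<forall>k\<in>J. V k > 0) \<and> (\<Sum>k\<in>J. V k * fourth_coeff CARD('n) k / (r k)\<^sup>2) = 0 \<and>
      (\<Sum>k\<in>J. V k * fourth_coeff CARD('n) k) = 0 \<and> (\<Sum>k\<in>J. V k * sixth_coeff CARD('n) k) = 0)"
    (is "(\<exists>wk. _ \<and> ?D7 wk) \<longleftrightarrow> (\<exists>V. _ \<and> ?E7 V)")
proof -
  let ?s = "\<lambda>k. real (card (Ink k :: (real^'n) set)) * r k ^ 6 / (real k)\<^sup>2"
  have s: "?s k > 0" if "k \<in> J" for k
  proof -
    have "k > 0" "r k > 0" "k \<le> CARD('n)"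
      using adm that by (force simp: admissible_def)+
    then show ?thesis
      using card_Ink_pos[where 'n = 'n, of k] by simp
  qed
  have 1: "(\<forall>k\<in>J. wk k * ?s k > 0) \<and> (?D5 wk \<longleftrightarrow> ?E5 (\<lambda>k. wk k * ?s k)) \<and> (?D7 wk \<longleftrightarrow> ?E7 (\<lambda>k. wk k * ?s k))"
    if "pos_weights J wk" for wk
  proof -
    have eq: "wk k * ?s k = wk k * real (card (Ink k :: (real^'n) set)) * r k ^ 6 / (real k)\<^sup>2" for k
      by (simp only: times_divide_eq_right mult.assoc)
    have "\<forall>k\<in>J. wk k * ?s k > 0"
      using that s unfolding pos_weights_def by (blast intro: mult_pos_pos)
    then show ?thesis
      using design_iff_coeffs[OF adm n eq] by blast
  qed
  have 2: "pos_weights J (\<lambda>k. V k / ?s k) \<and> (?D5 (\<lambda>k. V k / ?s k) \<longleftrightarrow> ?E5 V) \<and> (?D7 (\<lambda>k. V k / ?s k) \<longleftrightarrow> ?E7 V)"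
    if "\<forall>k\<in>J. V k > 0" for V
  proof -
    have eq: "V k = V k / ?s k * real (card (Ink k :: (real^'n) set)) * r k ^ 6 / (real k)\<^sup>2" if "k \<in> J" for k
    proof -
      have "V k = V k / ?s k * ?s k"
        using s[OF that] by (metis less_irrefl nonzero_eq_divide_eq)
      then show ?thesis
        by (simp only: times_divide_eq_right mult.assoc)
    qed
    have "pos_weights J (\<lambda>k. V k / ?s k)"
      unfolding pos_weights_def using that s by (blast intro: divide_pos_pos)
    then show ?thesis
      using design_iff_coeffs[OF adm n eq] by blast
  qed
  have *: "(\<exists>wk. pos_weights J wk \<and> D wk) \<longleftrightarrow> (\<exists>V. (\<forall>k\<in>J. V k > 0) \<and> E V)"
    if D: "\<And>wk. pos_weights J wk \<Longrightarrow> D wk \<longleftrightarrow> E (\<lambda>k. wk k * ?s k)"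
      and E: "\<And>V. \<forall>k\<in>J. V k > 0 \<Longrightarrow> D (\<lambda>k. V k / ?s k) \<longleftrightarrow> E V" for D E
  proof
    assume "\<exists>wk. pos_weights J wk \<and> D wk"
    then obtain wk where wk: "pos_weights J wk" "D wk"
      by blast
    show "\<exists>V. (\<forall>k\<in>J. V k > 0) \<and> E V"
      by (rule exI[of _ "\<lambda>k. wk k * ?s k"]) (use 1[OF wk(1)] D[OF wk(1)] wk(2) in blast)
  next
    assume "\<exists>V. (\<forall>k\<in>J. V k > 0) \<and> E V"
    then obtain V where V: "\<forall>k\<in>J. V k > 0" "E V"
      by blast
    show "\<exists>wk. pos_weights J wk \<and> D wk"
      by (rule exI[of _ "\<lambda>k. V k / ?s k"]) (use 2[OF V(1)] E[OF V(1)] V(2) in blast)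
  qed
  show "(\<exists>wk. pos_weights J wk \<and> ?D5 wk) \<longleftrightarrow> (\<exists>V. (\<forall>k\<in>J. V k > 0) \<and> ?E5 V)"
    by (rule *) (use 1 2 in blast)+
  show "(\<exists>wk. pos_weights J wk \<and> ?D7 wk) \<longleftrightarrow> (\<exists>V. (\<forall>k\<in>J. V k > 0) \<and> ?E7 V)"
    by (rule *) (use 1 2 in blast)+
qed

section \<open>Sign conditions on \<open>G\<close> for positive solutions\<close>

lemma coeff_det:
  "fourth_coeff n k * sixth_coeff n l - fourth_coeff n l * sixth_coeff n k =
    (real n + 2) * ((real k - real l) * of_int (Gfun n k l))"
  unfolding fourth_coeff_def sixth_coeff_def Gfun_def by (simp add: power2_eq_square algebra_simps)

lemma Gfun_commute: "Gfun n k l = Gfun n l k"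
  by (simp add: Gfun_def algebra_simps)

text \<open>The other two summands of \<open>Gfun\<close> are nonnegative and positive, so the first
  has to be negative: \<open>k\<close> and \<open>l\<close> lie strictly on opposite sides of
  \<open>(n + 2) / 3\<close>.\<close>

lemma Gfun_nonpos_imp:
  assumes "Gfun n k l \<le> 0" "1 \<le> k" "1 \<le> l" "n \<ge> 3"
  shows "(int n + 2 - 3 * int k) * (int n + 2 - 3 * int l) < 0"
proof -
  have "(int k - 1) * (int l - 1) \<ge> 0"
    using assms by (intro mult_nonneg_nonneg) auto
  moreover have "x < 0" if "x + 6 * y + 2 * (int n - 1) \<le> 0" "y \<ge> 0" for x y :: int
  proof -
    have "int n \<ge> 3"
      using assms(4) by simp
    then show ?thesis
      using that by presburger
  qed
  ultimately show ?thesis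
    using assms(1) unfolding Gfun_def mult.assoc by blast
qed

lemma Gfun_nonpos_less:
  assumes "Gfun n k l \<le> 0" "1 \<le> k" "k < l" "n \<ge> 3"
  shows "3 * k < n + 2" "n + 2 < 3 * l"
  using Gfun_nonpos_imp[of n k l] assms by (auto simp: mult_less_0_iff)

lemma ex_pos_pair_iff:
  fixes a1 a2 q1 q2 :: real
  assumes "q1 > 0" "q2 > 0"
  shows "(\<exists>x y. x > 0 \<and> y > 0 \<and> x * a1 / q1 + y * a2 / q2 = 0) \<longleftrightarrow> a1 * a2 < 0 \<or> a1 = 0 \<and> a2 = 0"
proof
  assume "\<exists>x y. x > 0 \<and> y > 0 \<and> x * a1 / q1 + y * a2 / q2 = 0"
  then obtain x y where xy: "x > 0" "y > 0" "x * a1 / q1 + y * a2 / q2 = 0"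
    by blast
  then have "x / q1 > 0" "y / q2 > 0" "(x / q1) * a1 = - ((y / q2) * a2)"
    using assms by simp_all
  then show "a1 * a2 < 0 \<or> a1 = 0 \<and> a2 = 0"
    by (smt (verit) mult_less_0_iff mult_pos_pos mult_pos_neg zero_less_mult_iff mult_eq_0_iff)
next
  assume "a1 * a2 < 0 \<or> a1 = 0 \<and> a2 = 0"
  then show "\<exists>x y. x > 0 \<and> y > 0 \<and> x * a1 / q1 + y * a2 / q2 = 0"
  proof
    assume "a1 * a2 < 0"
    \<comment> \<open>The factors \<open>q1\<close> and \<open>q2\<close> in the witnesses cancel
      the denominators and leave \<open>\<bar>a2\<bar> * a1 + \<bar>a1\<bar> * a2\<close>, which
      vanishes for opposite signs.\<close>
    then show ?thesis
      using assms
      by (intro exI[of _ "\<bar>a2\<bar> * q1"] exI[of _ "\<bar>a1\<bar> * q2"]) (auto simp: mult_less_0_iff)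
  next
    assume "a1 = 0 \<and> a2 = 0"
    then show ?thesis
      by (auto intro: exI[of _ 1])
  qed
qed

text \<open>By \<open>coeff_det\<close>, \<open>(c1, c2, c3)\<close> is the cross product of the two
  coefficient rows up to the factor \<open>n + 2\<close>, so a solution of the last two equations is
  proportional to it. The cyclic order of indices makes negativity of all three equivalent to the
  stated signs of \<open>G\<close>.\<close>

lemma ex_coeffs_three_iff:
  fixes q1 q2 q3 :: real
  assumes k: "1 \<le> k1" "k1 < k2" "k2 < k3" and n: "n \<ge> 3"
  shows "(\<exists>x y z. x > 0 \<and> y > 0 \<and> z > 0 \<and>
      x * fourth_coeff n k1 / q1 + y * fourth_coeff n k2 / q2 + z * fourth_coeff n k3 / q3 = 0 \<and>
      x * fourth_coeff n k1 + y * fourth_coeff n k2 + z * fourth_coeff n k3 = 0 \<and>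
      x * sixth_coeff n k1 + y * sixth_coeff n k2 + z * sixth_coeff n k3 = 0) \<longleftrightarrow>
    Gfun n k1 k2 > 0 \<and> Gfun n k2 k3 > 0 \<and> Gfun n k1 k3 < 0 \<and>
      fourth_coeff n k1 * (real k2 - real k3) * of_int (Gfun n k2 k3) / q1
      + fourth_coeff n k2 * (real k3 - real k1) * of_int (Gfun n k3 k1) / q2
      + fourth_coeff n k3 * (real k1 - real k2) * of_int (Gfun n k1 k2) / q3 = 0"
    (is "?L \<longleftrightarrow> ?R")
proof -
  define c1 c2 c3 :: real where "c1 = (real k2 - real k3) * of_int (Gfun n k2 k3)"
    and "c2 = (real k3 - real k1) * of_int (Gfun n k3 k1)"
    and "c3 = (real k1 - real k2) * of_int (Gfun n k1 k2)"
  define a1 a2 a3 P1 P2 P3 where "a1 = fourth_coeff n k1" "a2 = fourth_coeff n k2" "a3 = fourth_coeff n k3"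
    "P1 = sixth_coeff n k1" "P2 = sixth_coeff n k2" "P3 = sixth_coeff n k3"
  note coeffs = this
  have det: "a1 * P2 - a2 * P1 = (real n + 2) * c3" "a2 * P3 - a3 * P2 = (real n + 2) * c1"
    "a3 * P1 - a1 * P3 = (real n + 2) * c2"
    unfolding coeffs c1_def c2_def c3_def by (rule coeff_det)+
  have n2: "real n + 2 \<noteq> 0"
    by linarith
  have sgn: "c1 < 0 \<longleftrightarrow> Gfun n k2 k3 > 0" "c2 < 0 \<longleftrightarrow> Gfun n k1 k3 < 0" "c3 < 0 \<longleftrightarrow> Gfun n k1 k2 > 0"
      "c1 > 0 \<longleftrightarrow> Gfun n k2 k3 < 0" "c3 > 0 \<longleftrightarrow> Gfun n k1 k2 < 0"
    using k by (auto simp: c1_def c2_def c3_def mult_less_0_iff zero_less_mult_iff Gfun_commute[of n k3])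
  \<comment> \<open>Otherwise \<open>Gfun n k1 k2\<close> and \<open>Gfun n k2 k3\<close> are both
    nonpositive, and \<open>3 * k2\<close> would be above and below \<open>n + 2\<close> at once.
    This excludes the positive common sign and the zero vector.\<close>
  have not_both: "\<not> (c1 \<ge> 0 \<and> c3 \<ge> 0)"
    using Gfun_nonpos_less(2)[of n k1 k2] Gfun_nonpos_less(1)[of n k2 k3] k n sgn(1,3)
    by linarith
  have "?L \<longleftrightarrow> c1 < 0 \<and> c2 < 0 \<and> c3 < 0 \<and> a1 * c1 / q1 + a2 * c2 / q2 + a3 * c3 / q3 = 0"
    unfolding coeffs[symmetric]
  proof (intro iffI)
    assume "\<exists>x y z. x > 0 \<and> y > 0 \<and> z > 0 \<and> x * a1 / q1 + y * a2 / q2 + z * a3 / q3 = 0 \<and>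
      x * a1 + y * a2 + z * a3 = 0 \<and> x * P1 + y * P2 + z * P3 = 0"
    then obtain x y z where pos: "x > 0" "y > 0" "z > 0"
      and eq: "x * a1 / q1 + y * a2 / q2 + z * a3 / q3 = 0" "x * a1 + y * a2 + z * a3 = 0"
        "x * P1 + y * P2 + z * P3 = 0"
      by blast
    have "(real n + 2) * (x * c3) = (real n + 2) * (z * c1)" "(real n + 2) * (y * c3) = (real n + 2) * (z * c2)"
      using det eq(2,3) by algebra+
    then have x: "x * c3 = z * c1" and y: "y * c3 = z * c2"
      using n2 by simp_all
    have "c3 < 0"
    proof (rule ccontr)
      assume "\<not> c3 < 0"
      then have "z * c1 \<ge> 0"
        using pos by (simp flip: x)
      then show False
        using not_both \<open>\<not> c3 < 0\<close> pos by (simp add: zero_le_mult_iff)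
    qed
    then have "z * c1 < 0" "z * c2 < 0"
      using pos by (simp_all flip: x y add: mult_pos_neg)
    then have "c1 < 0" "c2 < 0"
      using pos by (simp_all add: mult_less_0_iff)
    moreover have "z * (a1 * c1 / q1 + a2 * c2 / q2 + a3 * c3 / q3) = 0"
    proof -
      have "z * (a1 * c1 / q1 + a2 * c2 / q2 + a3 * c3 / q3) =
          a1 * (z * c1) / q1 + a2 * (z * c2) / q2 + z * a3 * c3 / q3"
        by (simp add: algebra_simps)
      also have "\<dots> = c3 * (x * a1 / q1 + y * a2 / q2 + z * a3 / q3)"
        unfolding x[symmetric] y[symmetric] by (simp add: algebra_simps)
      finally show ?thesis
        using eq(1) by simp
    qed
    ultimately show "c1 < 0 \<and> c2 < 0 \<and> c3 < 0 \<and> a1 * c1 / q1 + a2 * c2 / q2 + a3 * c3 / q3 = 0"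
      using \<open>c3 < 0\<close> pos by simp
  next
    assume c: "c1 < 0 \<and> c2 < 0 \<and> c3 < 0 \<and> a1 * c1 / q1 + a2 * c2 / q2 + a3 * c3 / q3 = 0"
    \<comment> \<open>A cross product is orthogonal to both of its factors; its negative is the
      positive solution.\<close>
    have "(real n + 2) * (a1 * c1 + a2 * c2 + a3 * c3) = 0" "(real n + 2) * (P1 * c1 + P2 * c2 + P3 * c3) = 0"
      using det by algebra+
    then have "a1 * c1 + a2 * c2 + a3 * c3 = 0" "P1 * c1 + P2 * c2 + P3 * c3 = 0"
      using n2 by simp_all
    then show "\<exists>x y z. x > 0 \<and> y > 0 \<and> z > 0 \<and> x * a1 / q1 + y * a2 / q2 + z * a3 / q3 = 0 \<and>
      x * a1 + y * a2 + z * a3 = 0 \<and> x * P1 + y * P2 + z * P3 = 0"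
      using c by (intro exI[of _ "- c1"] exI[of _ "- c2"] exI[of _ "- c3"]) (simp add: mult.commute)
  qed
  from this[unfolded sgn] show ?thesis
    unfolding c1_def c2_def c3_def coeffs mult.assoc by (simp only: conj_ac)
qed

lemma ex_pos_fun_pair:
  assumes "k1 \<noteq> k2"
  shows "(\<exists>V. (\<forall>k\<in>{k1, k2}. V k > (0 :: real)) \<and> Q (V k1) (V k2)) \<longleftrightarrow> (\<exists>x y. x > 0 \<and> y > 0 \<and> Q x y)"
proof
  assume "\<exists>x y. x > 0 \<and> y > 0 \<and> Q x y"
  then obtain x y where "x > 0" "y > 0" "Q x y"
    by blast
  then show "\<exists>V. (\<forall>k\<in>{k1, k2}. V k > 0) \<and> Q (V k1) (V k2)"
    using assms by (intro exI[of _ "\<lambda>k. if k = k1 then x else y"]) auto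
qed auto

lemma ex_pos_fun_triple:
  assumes "k1 \<noteq> k2" "k1 \<noteq> k3" "k2 \<noteq> k3"
  shows "(\<exists>V. (\<forall>k\<in>{k1, k2, k3}. V k > (0 :: real)) \<and> Q (V k1) (V k2) (V k3)) \<longleftrightarrow>
    (\<exists>x y z. x > 0 \<and> y > 0 \<and> z > 0 \<and> Q x y z)"
proof
  assume "\<exists>x y z. x > 0 \<and> y > 0 \<and> z > 0 \<and> Q x y z"
  then obtain x y z where "x > 0" "y > 0" "z > 0" "Q x y z"
    by blast
  then show "\<exists>V. (\<forall>k\<in>{k1, k2, k3}. V k > 0) \<and> Q (V k1) (V k2) (V k3)"
    using assms by (intro exI[of _ "\<lambda>k. if k = k1 then x else if k = k2 then y else z"]) auto
qed auto

section \<open>Weights for one, two and three shells\<close>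

context
  fixes r :: "nat \<Rightarrow> real"
  assumes n: "CARD('n::finite) \<ge> 3"
begin

lemma single_design_5_iff:
  assumes adm: "admissible CARD('n) {k} r"
  shows "(\<exists>wk. pos_weights {k} wk \<and>
      euclidean_design (XJ {k} r :: (real^'n) set) (layer_wfun wk) 5) \<longleftrightarrow> 3 * k = CARD('n) + 2"
proof -
  have "k > 0" "r k > 0"
    using adm by (auto simp: admissible_def)
  then show ?thesis
    unfolding ex_design_iff_ex_coeffs[OF adm n] by (auto simp: fourth_coeff_def intro!: exI[of _ "\<lambda>_. 1"])
qed

lemma single_not_design_7:
  assumes adm: "admissible CARD('n) {k} r"
  shows "\<not> (\<exists>wk. pos_weights {k} wk \<and>
      euclidean_design (XJ {k} r :: (real^'n) set) (layer_wfun wk) 7)"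
proof
  assume "(\<exists>wk. pos_weights {k} wk \<and>
      euclidean_design (XJ {k} r :: (real^'n) set) (layer_wfun wk) 7)"
  moreover have "k > 0"
    using adm by (auto simp: admissible_def)
  ultimately have "real CARD('n) + 2 - 3 * real k = 0"
      "(real CARD('n) + 2) * (real CARD('n) + 4) - 15 * (real k)\<^sup>2 = 0"
    unfolding ex_design_iff_ex_coeffs[OF adm n] by (auto simp: fourth_coeff_def sixth_coeff_def)
  \<comment> \<open>Substituting \<open>3 * k = n + 2\<close> into the second equation turns
    \<open>15 * k^2\<close> into \<open>5/3 * (n + 2)^2\<close>, and the difference is
    \<open>- 2/3 * (n + 2) * (n - 1)\<close>.\<close>
  then have "(real CARD('n) + 2) * (real CARD('n) - 1) = 0"
    by algebra
  then show False
    using n by auto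
qed

text \<open>The radii enter only through positive factors, so one criterion covers equal and unequal
  radii. Both coefficients cannot vanish, as \<open>3 * k = n + 2\<close> has at most one
  solution.\<close>

lemma pair_design_5_iff:
  assumes adm: "admissible CARD('n) {k1, k2} r" and k: "k1 < k2"
  shows "(\<exists>wk. pos_weights {k1, k2} wk \<and>
      euclidean_design (XJ {k1, k2} r :: (real^'n) set) (layer_wfun wk) 5) \<longleftrightarrow> 3 * k1 < CARD('n) + 2 \<and> CARD('n) + 2 < 3 * k2"
proof -
  have pos: "k1 > 0" "k2 > 0" "r k1 > 0" "r k2 > 0"
    using adm by (auto simp: admissible_def)
  let ?u = "\<lambda>k. real CARD('n) + 2 - 3 * real k"
  have "(\<exists>wk. pos_weights {k1, k2} wk \<and>
      euclidean_design (XJ {k1, k2} r :: (real^'n) set) (layer_wfun wk) 5) \<longleftrightarrow> (\<exists>x y. x > 0 \<and> y > 0 \<and>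
      x * fourth_coeff CARD('n) k1 / (r k1)\<^sup>2 + y * fourth_coeff CARD('n) k2 / (r k2)\<^sup>2 = 0)"
    unfolding ex_design_iff_ex_coeffs[OF adm n] using k by (subst ex_pos_fun_pair[symmetric]) auto
  also have "\<dots> \<longleftrightarrow> fourth_coeff CARD('n) k1 * fourth_coeff CARD('n) k2 < 0 \<or>
      fourth_coeff CARD('n) k1 = 0 \<and> fourth_coeff CARD('n) k2 = 0"
    using pos by (intro ex_pos_pair_iff) auto
  also have "\<dots> \<longleftrightarrow> ?u k1 > 0 \<and> ?u k2 < 0"
    using pos k by (auto simp: fourth_coeff_def mult_less_0_iff zero_less_mult_iff)
  also have "\<dots> \<longleftrightarrow> 3 * k1 < CARD('n) + 2 \<and> CARD('n) + 2 < 3 * k2"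
    by linarith
  finally show ?thesis .
qed

text \<open>Comparing the two equations in \<open>fourth_coeff\<close> forces equal radii, since
  neither coefficient can vanish alone or together with the other. What remains is a homogeneous
  system of two equations, with the minor \<open>G\<close> up to nonzero factors.\<close>

lemma pair_design_7_iff:
  assumes adm: "admissible CARD('n) {k1, k2} r" and k: "k1 \<noteq> k2"
  shows "(\<exists>wk. pos_weights {k1, k2} wk \<and>
      euclidean_design (XJ {k1, k2} r :: (real^'n) set) (layer_wfun wk) 7) \<longleftrightarrow> r k1 = r k2 \<and> Gfun CARD('n) k1 k2 = 0"
proof -
  let ?n = "CARD('n)"
  have pos: "k1 > 0" "k2 > 0" "r k1 > 0" "r k2 > 0"
    using adm by (auto simp: admissible_def)
  define a1 a2 P1 P2 where "a1 = fourth_coeff ?n k1" "a2 = fourth_coeff ?n k2"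
    "P1 = sixth_coeff ?n k1" "P2 = sixth_coeff ?n k2"
  note coeffs = this
  have det: "a1 * P2 - a2 * P1 = (real ?n + 2) * ((real k1 - real k2) * of_int (Gfun ?n k1 k2))"
    unfolding coeffs by (rule coeff_det)
  have det0: "a1 * P2 = a2 * P1 \<longleftrightarrow> Gfun ?n k1 k2 = 0"
  proof -
    have "real ?n + 2 \<noteq> 0"
      by linarith
    then show ?thesis
      using det k by (metis eq_iff_diff_eq_0 mult_eq_0_iff of_int_eq_0_iff of_nat_eq_iff)
  qed
  have not_both: "\<not> (a1 = 0 \<and> a2 = 0)"
    using k pos by (auto simp: coeffs fourth_coeff_def)
  have "(\<exists>wk. pos_weights {k1, k2} wk \<and>
      euclidean_design (XJ {k1, k2} r :: (real^'n) set) (layer_wfun wk) 7) \<longleftrightarrow> (\<exists>x y. x > 0 \<and> y > 0 \<and> x * a1 / (r k1)\<^sup>2 + y * a2 / (r k2)\<^sup>2 = 0 \<and>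
      x * a1 + y * a2 = 0 \<and> x * P1 + y * P2 = 0)"
    unfolding ex_design_iff_ex_coeffs[OF adm n] coeffs using k by (subst ex_pos_fun_pair[symmetric]) auto
  also have "\<dots> \<longleftrightarrow> r k1 = r k2 \<and> Gfun ?n k1 k2 = 0"
  proof
    assume "\<exists>x y. x > 0 \<and> y > 0 \<and> x * a1 / (r k1)\<^sup>2 + y * a2 / (r k2)\<^sup>2 = 0 \<and>
      x * a1 + y * a2 = 0 \<and> x * P1 + y * P2 = 0"
    then obtain x y where xy: "x > 0" "y > 0" "x * a1 / (r k1)\<^sup>2 + y * a2 / (r k2)\<^sup>2 = 0"
      "x * a1 + y * a2 = 0" "x * P1 + y * P2 = 0"
      by blast
    have "x * (a1 * P2 - a2 * P1) = 0"
      using xy(4,5) by algebra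
    then have "Gfun ?n k1 k2 = 0"
      using xy(1) det0 by simp
    moreover have "r k1 = r k2"
    proof -
      have eq: "x * a1 = - (y * a2)"
        using xy(4) by simp
      have "y * a2 * (1 / (r k2)\<^sup>2 - 1 / (r k1)\<^sup>2) = 0"
        using xy(3) unfolding eq by (simp add: algebra_simps)
      moreover have "a2 \<noteq> 0"
        using eq not_both xy(1) by auto
      ultimately have "(r k1)\<^sup>2 = (r k2)\<^sup>2"
        using xy(2) by simp
      then show ?thesis
        using pos by (simp add: power2_eq_iff_nonneg)
    qed
    ultimately show "r k1 = r k2 \<and> Gfun ?n k1 k2 = 0"
      by simp
  next
    assume G: "r k1 = r k2 \<and> Gfun ?n k1 k2 = 0"
    \<comment> \<open>A vanishing minor makes \<open>(- a2, a1)\<close> solve both equations. That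
      it can be made positive needs opposite signs of \<open>a1\<close> and \<open>a2\<close>, and
      \<open>G = 0\<close> yields these too.\<close>
    have "(int ?n + 2 - 3 * int k1) * (int ?n + 2 - 3 * int k2) < 0"
      using G pos n by (intro Gfun_nonpos_imp) auto
    then have "a1 * a2 < 0"
      using pos by (auto simp: coeffs fourth_coeff_def mult_less_0_iff zero_less_mult_iff)
    then consider "a1 > 0" "a2 < 0" | "a1 < 0" "a2 > 0"
      by (auto simp: mult_less_0_iff)
    then show "\<exists>x y. x > 0 \<and> y > 0 \<and> x * a1 / (r k1)\<^sup>2 + y * a2 / (r k2)\<^sup>2 = 0 \<and>
      x * a1 + y * a2 = 0 \<and> x * P1 + y * P2 = 0"
    proof cases
      case 1
      then show ?thesis
        using G det0 by (intro exI[of _ "- a2"] exI[of _ a1]) (simp add: mult.commute)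
    next
      case 2
      then show ?thesis
        using G det0 by (intro exI[of _ a2] exI[of _ "- a1"]) (simp add: mult.commute)
    qed
  qed
  finally show ?thesis .
qed

lemma triple_design_7_iff:
  assumes adm: "admissible CARD('n) {k1, k2, k3} r" and k: "k1 < k2" "k2 < k3"
  shows "(\<exists>wk. pos_weights {k1, k2, k3} wk \<and>
      euclidean_design (XJ {k1, k2, k3} r :: (real^'n) set) (layer_wfun wk) 7) \<longleftrightarrow>
    Gfun CARD('n) k1 k2 > 0 \<and> Gfun CARD('n) k2 k3 > 0 \<and> Gfun CARD('n) k1 k3 < 0 \<and>
      fourth_coeff CARD('n) k1 * (real k2 - real k3) * of_int (Gfun CARD('n) k2 k3) / (r k1)\<^sup>2
      + fourth_coeff CARD('n) k2 * (real k3 - real k1) * of_int (Gfun CARD('n) k3 k1) / (r k2)\<^sup>2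
      + fourth_coeff CARD('n) k3 * (real k1 - real k2) * of_int (Gfun CARD('n) k1 k2) / (r k3)\<^sup>2 = 0"
proof -
  have "1 \<le> k1"
    using adm by (auto simp: admissible_def)
  from ex_coeffs_three_iff[OF this k n, of "(r k1)\<^sup>2" "(r k2)\<^sup>2" "(r k3)\<^sup>2"] show ?thesis
    unfolding ex_design_iff_ex_coeffs[OF adm n]
    using k by (subst (asm) ex_pos_fun_triple[of k1 k2 k3, symmetric]) (auto simp: add.assoc)
qed

end

text \<open>Times \<open>n + 2\<close> this is the expansion of a \<open>3 \<times> 3\<close>
  determinant whose row of fourth-degree coefficients occurs twice. For equal radii it makes the
  condition on the radii automatic.\<close>

lemma coeff_det_sum:
  "fourth_coeff n k1 * (real k2 - real k3) * of_int (Gfun n k2 k3)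
  + fourth_coeff n k2 * (real k3 - real k1) * of_int (Gfun n k3 k1)
  + fourth_coeff n k3 * (real k1 - real k2) * of_int (Gfun n k1 k2) = 0"
proof -
  have "(real n + 2) * (fourth_coeff n k1 * (real k2 - real k3) * of_int (Gfun n k2 k3)
    + fourth_coeff n k2 * (real k3 - real k1) * of_int (Gfun n k3 k1)
    + fourth_coeff n k3 * (real k1 - real k2) * of_int (Gfun n k1 k2)) = 0"
    using coeff_det[of n k2 k3] coeff_det[of n k3 k1] coeff_det[of n k1 k2] by algebra
  moreover have "real n + 2 \<noteq> 0"
    by linarith
  ultimately show ?thesis
    by simp
qed

text \<open>If exactly one radius \<open>r k\<^sub>i\<close> differs from the other two, the condition on the radii together
  with \<open>coeff_det_sum\<close> forces the \<open>i\<close>-th term, hence \<open>n + 2 - 3 * k\<^sub>i\<close>, to vanish; the signs of the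
  remaining two terms then leave only \<open>i = 2\<close>.\<close>
lemma two_radii_iff:
  fixes r1 r2 r3 :: real
  assumes r: "r1 > 0" "r2 > 0" "r3 > 0" "card {r1, r2, r3} = 2"
    and k: "1 \<le> k1" "k1 < k2" "k2 < k3" and n: "n \<ge> 3"
  shows "Gfun n k1 k2 > 0 \<and> Gfun n k2 k3 > 0 \<and> Gfun n k1 k3 < 0 \<and>
      fourth_coeff n k1 * (real k2 - real k3) * of_int (Gfun n k2 k3) / r1\<^sup>2
      + fourth_coeff n k2 * (real k3 - real k1) * of_int (Gfun n k3 k1) / r2\<^sup>2
      + fourth_coeff n k3 * (real k1 - real k2) * of_int (Gfun n k1 k2) / r3\<^sup>2 = 0 \<longleftrightarrow>
    3 * k2 = n + 2 \<and> r1 = r3 \<and> Gfun n k1 k3 < 0"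
    (is "?L \<longleftrightarrow> ?R")
proof -
  define t1 t2 t3 where "t1 = fourth_coeff n k1 * (real k2 - real k3) * of_int (Gfun n k2 k3)"
    "t2 = fourth_coeff n k2 * (real k3 - real k1) * of_int (Gfun n k3 k1)"
    "t3 = fourth_coeff n k3 * (real k1 - real k2) * of_int (Gfun n k1 k2)"
  note t = this
  have t_sum: "t1 + t2 + t3 = 0"
    unfolding t by (rule coeff_det_sum)
  let ?u = "\<lambda>k. real n + 2 - 3 * real k"
  show ?thesis
    unfolding t[symmetric]
  proof
    assume L: "Gfun n k1 k2 > 0 \<and> Gfun n k2 k3 > 0 \<and> Gfun n k1 k3 < 0 \<and>
      t1 / r1\<^sup>2 + t2 / r2\<^sup>2 + t3 / r3\<^sup>2 = 0"
    then have G: "Gfun n k3 k1 < 0"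
      by (simp add: Gfun_commute)
    \<comment> \<open>In each term the factor besides \<open>fourth_coeff\<close> is negative, so
      the term has the sign opposite to \<open>n + 2 - 3 * k\<close>.\<close>
    have sgn: "t1 > 0 \<longleftrightarrow> ?u k1 < 0" "t1 = 0 \<longleftrightarrow> ?u k1 = 0" "t1 < 0 \<longleftrightarrow> ?u k1 > 0"
        "t2 > 0 \<longleftrightarrow> ?u k2 < 0" "t2 = 0 \<longleftrightarrow> ?u k2 = 0" "t2 < 0 \<longleftrightarrow> ?u k2 > 0"
        "t3 > 0 \<longleftrightarrow> ?u k3 < 0" "t3 = 0 \<longleftrightarrow> ?u k3 = 0" "t3 < 0 \<longleftrightarrow> ?u k3 > 0"
      using L G k unfolding t fourth_coeff_def
      by (auto simp: zero_less_mult_iff mult_less_0_iff)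
    have mono: "?u k1 > ?u k2" "?u k2 > ?u k3"
      using k by simp_all
    have sq: "x\<^sup>2 = y\<^sup>2 \<longleftrightarrow> x = y" if "x > 0" "y > 0" for x y :: real
      using that by (simp add: power2_eq_iff_nonneg)
    consider "r1 = r3" "r2 \<noteq> r1" | "r1 = r2" "r3 \<noteq> r1" | "r2 = r3" "r1 \<noteq> r2"
      using r(4) by (cases "r1 = r2"; cases "r1 = r3"; cases "r2 = r3") auto
    then have "r1 = r3 \<and> ?u k2 = 0"
    proof cases
      case 1
      \<comment> \<open>Subtracting \<open>t_sum\<close> divided by the square of the repeated
        radius removes the two terms with that radius.\<close>
      have "t2 * (1 / r2\<^sup>2 - 1 / r1\<^sup>2) = (t1 / r1\<^sup>2 + t2 / r2\<^sup>2 + t3 / r3\<^sup>2) - (t1 + t2 + t3) / r1\<^sup>2"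
        using 1 by (simp add: algebra_simps add_divide_distrib)
      then have "t2 = 0"
        using L t_sum 1 r sq[of r2 r1] by simp
      then show ?thesis
        using 1 sgn by simp
    next
      case 2
      have "t3 * (1 / r3\<^sup>2 - 1 / r1\<^sup>2) = (t1 / r1\<^sup>2 + t2 / r2\<^sup>2 + t3 / r3\<^sup>2) - (t1 + t2 + t3) / r1\<^sup>2"
        using 2 by (simp add: algebra_simps add_divide_distrib)
      then have "t3 = 0"
        using L t_sum 2 r sq[of r3 r1] by simp
      then have "?u k3 = 0"
        using sgn by simp
      then have "?u k1 > 0" "?u k2 > 0"
        using mono by linarith+
      then have "t1 < 0" "t2 < 0"
        using sgn by blast+
      then show ?thesis
        using t_sum \<open>t3 = 0\<close> by linarith
    next
      case 3
      have "t1 * (1 / r1\<^sup>2 - 1 / r2\<^sup>2) = (t1 / r1\<^sup>2 + t2 / r2\<^sup>2 + t3 / r3\<^sup>2) - (t1 + t2 + t3) / r2\<^sup>2"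
        using 3 by (simp add: algebra_simps add_divide_distrib)
      then have "t1 = 0"
        using L t_sum 3 r sq[of r1 r2] by simp
      then have "?u k1 = 0"
        using sgn by simp
      then have "?u k2 < 0" "?u k3 < 0"
        using mono by linarith+
      then have "t2 > 0" "t3 > 0"
        using sgn by blast+
      then show ?thesis
        using t_sum \<open>t1 = 0\<close> by linarith
    qed
    then show ?R
      using L by (simp; linarith)
  next
    assume R: ?R
    \<comment> \<open>A nonpositive value would put \<open>3 * k2\<close> strictly to one side of
      \<open>n + 2\<close>.\<close>
    then have "\<not> Gfun n k1 k2 \<le> 0" "\<not> Gfun n k2 k3 \<le> 0"
      using Gfun_nonpos_less(2)[of n k1 k2] Gfun_nonpos_less(1)[of n k2 k3] k n by auto
    moreover have "t2 = 0"
      using R by (simp add: t fourth_coeff_def)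
    moreover have "t1 / r3\<^sup>2 + t3 / r3\<^sup>2 = 0"
      using t_sum \<open>t2 = 0\<close> by (simp flip: add_divide_distrib)
    ultimately show "Gfun n k1 k2 > 0 \<and> Gfun n k2 k3 > 0 \<and> Gfun n k1 k3 < 0 \<and>
      t1 / r1\<^sup>2 + t2 / r2\<^sup>2 + t3 / r3\<^sup>2 = 0"
      using R by simp
  qed
qed

theorem theorem1p3:
  fixes dummy :: "'n::finite itself"
  defines "n \<equiv> CARD('n)"
  assumes "n \<ge> 3"
  shows
  \<comment> \<open>1.\<close>
  "(\<forall>J r wk. admissible n J r \<and> pos_weights J wk \<longrightarrow>
      design_strength (XJ J r :: (real^'n) set) (layer_wfun wk) \<in> {3, 5, 7})
  \<comment> \<open>2(a)\<close>
  \<and> (\<forall>J r k. admissible n J r \<and> card (r ` J) = 1 \<and> J = {k} \<longrightarrow>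
      ((\<exists>wk. pos_weights J wk \<and> euclidean_design (XJ J r :: (real^'n) set) (layer_wfun wk) 5)
        \<longleftrightarrow> (n mod 3 = 1 \<and> 3 * k = n + 2)))
  \<comment> \<open>2(b)\<close>
  \<and> (\<forall>J r wk. admissible n J r \<and> card (r ` J) = 1 \<and> card J = 1 \<and> pos_weights J wk \<longrightarrow>
      \<not> euclidean_design (XJ J r :: (real^'n) set) (layer_wfun wk) 7)
  \<comment> \<open>2(c)\<close>
  \<and> (\<forall>J r k1 k2. admissible n J r \<and> card (r ` J) = 1 \<and> J = {k1, k2} \<and> k1 < k2 \<longrightarrow>
      ((\<exists>wk. pos_weights J wk \<and> euclidean_design (XJ J r :: (real^'n) set) (layer_wfun wk) 5)
        \<longleftrightarrow> (3 * k1 < n + 2 \<and> n + 2 < 3 * k2)))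
  \<comment> \<open>2(d)\<close>
  \<and> (\<forall>J r k1 k2. admissible n J r \<and> card (r ` J) = 1 \<and> J = {k1, k2} \<and> k1 \<noteq> k2 \<longrightarrow>
      ((\<exists>wk. pos_weights J wk \<and> euclidean_design (XJ J r :: (real^'n) set) (layer_wfun wk) 7)
        \<longleftrightarrow> Gfun n k1 k2 = 0))
  \<comment> \<open>2(e)\<close>
  \<and> (\<forall>J r k1 k2 k3. admissible n J r \<and> card (r ` J) = 1 \<and> J = {k1, k2, k3} \<and> k1 < k2 \<and> k2 < k3 \<longrightarrow>
      ((\<exists>wk. pos_weights J wk \<and> euclidean_design (XJ J r :: (real^'n) set) (layer_wfun wk) 7)
        \<longleftrightarrow> (Gfun n k1 k2 > 0 \<and> Gfun n k2 k3 > 0 \<and> Gfun n k1 k3 < 0)))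
  \<comment> \<open>3(a)\<close>
  \<and> (\<forall>J r k1 k2. admissible n J r \<and> card (r ` J) = 2 \<and> J = {k1, k2} \<and> k1 < k2 \<longrightarrow>
      ((\<exists>wk. pos_weights J wk \<and> euclidean_design (XJ J r :: (real^'n) set) (layer_wfun wk) 5)
        \<longleftrightarrow> (3 * k1 < n + 2 \<and> n + 2 < 3 * k2)))
  \<comment> \<open>3(b)\<close>
  \<and> (\<forall>J r wk. admissible n J r \<and> card (r ` J) = 2 \<and> card J = 2 \<and> pos_weights J wk \<longrightarrow>
      \<not> euclidean_design (XJ J r :: (real^'n) set) (layer_wfun wk) 7)
  \<comment> \<open>3(c)\<close>
  \<and> (\<forall>J r k1 k2 k3. admissible n J r \<and> card (r ` J) = 2 \<and> J = {k1, k2, k3} \<and> k1 < k2 \<and> k2 < k3 \<longrightarrow>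
      ((\<exists>wk. pos_weights J wk \<and> euclidean_design (XJ J r :: (real^'n) set) (layer_wfun wk) 7)
        \<longleftrightarrow> (n mod 3 = 1 \<and> 3 * k2 = n + 2 \<and> r k1 = r k3 \<and> Gfun n k1 k3 < 0)))
  \<comment> \<open>4.\<close>
  \<and> (\<forall>J r k1 k2 k3. admissible n J r \<and> card (r ` J) = 3 \<and> J = {k1, k2, k3} \<and> k1 < k2 \<and> k2 < k3 \<longrightarrow>
      ((\<exists>wk. pos_weights J wk \<and> euclidean_design (XJ J r :: (real^'n) set) (layer_wfun wk) 7)
        \<longleftrightarrow> (Gfun n k1 k2 > 0 \<and> Gfun n k2 k3 > 0 \<and> Gfun n k1 k3 < 0 \<and>
             real k1 * (real n + 2 - 3 * real k1) * (real k2 - real k3) * of_int (Gfun n k2 k3) / (r k1)^2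
           + real k2 * (real n + 2 - 3 * real k2) * (real k3 - real k1) * of_int (Gfun n k3 k1) / (r k2)^2
           + real k3 * (real n + 2 - 3 * real k3) * (real k1 - real k2) * of_int (Gfun n k1 k2) / (r k3)^2
           = 0)))"
proof (intro conjI allI impI)
  have n: "CARD('n) \<ge> 3"
    using assms(2) by (simp add: n_def)
  note single = single_design_5_iff[OF n] single_not_design_7[OF n]
  note pair5 = pair_design_5_iff[OF n]
  note pair7 = pair_design_7_iff[OF n]
  note triple7 = triple_design_7_iff[OF n]
  have radii_pair: "card (r ` {k1, k2}) = 1 \<longleftrightarrow> r k1 = r k2" for r :: "nat \<Rightarrow> real" and k1 k2
    by (cases "r k1 = r k2") auto
  show "design_strength (XJ J r :: (real^'n) set) (layer_wfun wk) \<in> {3, 5, 7}"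
    if "admissible n J r \<and> pos_weights J wk" for J r wk
    using design_strength_cases[OF _ n] that by (simp only: n_def)
  show "(\<exists>wk. pos_weights J wk \<and> euclidean_design (XJ J r :: (real^'n) set) (layer_wfun wk) 5)
      \<longleftrightarrow> (n mod 3 = 1 \<and> 3 * k = n + 2)"
    if "admissible n J r \<and> card (r ` J) = 1 \<and> J = {k}" for J r k
  proof -
    have "n mod 3 = 1" if "3 * k = n + 2"
      using that by presburger
    then show ?thesis
      using single(1) that unfolding n_def by blast
  qed
  show "\<not> euclidean_design (XJ J r :: (real^'n) set) (layer_wfun wk) 7"
    if "admissible n J r \<and> card (r ` J) = 1 \<and> card J = 1 \<and> pos_weights J wk" for J r wk
    using single(2) that unfolding n_def card_1_singleton_iff One_nat_def by blast
  show "(\<exists>wk. pos_weights J wk \<and> euclidean_design (XJ J r :: (real^'n) set) (layer_wfun wk) 5)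
      \<longleftrightarrow> (3 * k1 < n + 2 \<and> n + 2 < 3 * k2)"
    if "admissible n J r \<and> card (r ` J) = 1 \<and> J = {k1, k2} \<and> k1 < k2" for J r k1 k2
    using pair5 that unfolding n_def by blast
  show "(\<exists>wk. pos_weights J wk \<and> euclidean_design (XJ J r :: (real^'n) set) (layer_wfun wk) 7)
      \<longleftrightarrow> Gfun n k1 k2 = 0"
    if "admissible n J r \<and> card (r ` J) = 1 \<and> J = {k1, k2} \<and> k1 \<noteq> k2" for J r k1 k2
    using pair7 radii_pair that unfolding n_def by blast
  show "(\<exists>wk. pos_weights J wk \<and> euclidean_design (XJ J r :: (real^'n) set) (layer_wfun wk) 7)
      \<longleftrightarrow> (Gfun n k1 k2 > 0 \<and> Gfun n k2 k3 > 0 \<and> Gfun n k1 k3 < 0)"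
    if J: "admissible n J r \<and> card (r ` J) = 1 \<and> J = {k1, k2, k3} \<and> k1 < k2 \<and> k2 < k3" for J r k1 k2 k3
  proof -
    have "r k1 = r k2" "r k2 = r k3"
      using J by (auto simp: card_1_singleton_iff)
    moreover have "admissible CARD('n) {k1, k2, k3} r" "k1 < k2" "k2 < k3" "J = {k1, k2, k3}"
      using J by (auto simp: n_def)
    ultimately show ?thesis
      \<comment> \<open>With one common radius, the last condition is \<open>coeff_det_sum\<close>
        divided by its square.\<close>
      using triple7[of k1 k2 k3 r] coeff_det_sum[of n k1 k2 k3]
      by (simp add: n_def flip: add_divide_distrib)
  qed
  show "(\<exists>wk. pos_weights J wk \<and> euclidean_design (XJ J r :: (real^'n) set) (layer_wfun wk) 5)
      \<longleftrightarrow> (3 * k1 < n + 2 \<and> n + 2 < 3 * k2)"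
    if "admissible n J r \<and> card (r ` J) = 2 \<and> J = {k1, k2} \<and> k1 < k2" for J r k1 k2
    using pair5 that unfolding n_def by blast
  show "\<not> euclidean_design (XJ J r :: (real^'n) set) (layer_wfun wk) 7"
    if J: "admissible n J r \<and> card (r ` J) = 2 \<and> card J = 2 \<and> pos_weights J wk" for J r wk
  proof -
    obtain k1 k2 where "J = {k1, k2}" "k1 \<noteq> k2"
      using J by (auto simp: card_2_iff)
    moreover from this have "r k1 \<noteq> r k2"
      using J by auto
    ultimately show ?thesis
      using pair7[of k1 k2 r] J unfolding n_def by blast
  qed
  show "(\<exists>wk. pos_weights J wk \<and> euclidean_design (XJ J r :: (real^'n) set) (layer_wfun wk) 7)
      \<longleftrightarrow> (n mod 3 = 1 \<and> 3 * k2 = n + 2 \<and> r k1 = r k3 \<and> Gfun n k1 k3 < 0)"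
    if J: "admissible n J r \<and> card (r ` J) = 2 \<and> J = {k1, k2, k3} \<and> k1 < k2 \<and> k2 < k3" for J r k1 k2 k3
  proof -
    have "n mod 3 = 1" if "3 * k2 = n + 2"
      using that by presburger
    moreover have "(\<exists>wk. pos_weights J wk \<and> euclidean_design (XJ J r :: (real^'n) set) (layer_wfun wk) 7)
        \<longleftrightarrow> 3 * k2 = n + 2 \<and> r k1 = r k3 \<and> Gfun n k1 k3 < 0"
    proof -
      have adm: "admissible CARD('n) {k1, k2, k3} r" and k: "k1 < k2" "k2 < k3"
        and Jeq: "J = {k1, k2, k3}" and card: "card {r k1, r k2, r k3} = 2"
        using J by (auto simp: n_def)
      have pos: "r k1 > 0" "r k2 > 0" "r k3 > 0" "1 \<le> k1"
        using adm by (auto simp: admissible_def)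
      show ?thesis
        unfolding Jeq triple7[OF adm k] n_def
        by (rule two_radii_iff[OF pos(1-3) card pos(4) k n])
    qed
    ultimately show ?thesis
      by blast
  qed
  show "(\<exists>wk. pos_weights J wk \<and> euclidean_design (XJ J r :: (real^'n) set) (layer_wfun wk) 7)
      \<longleftrightarrow> (Gfun n k1 k2 > 0 \<and> Gfun n k2 k3 > 0 \<and> Gfun n k1 k3 < 0 \<and>
           real k1 * (real n + 2 - 3 * real k1) * (real k2 - real k3) * of_int (Gfun n k2 k3) / (r k1)^2
         + real k2 * (real n + 2 - 3 * real k2) * (real k3 - real k1) * of_int (Gfun n k3 k1) / (r k2)^2
         + real k3 * (real n + 2 - 3 * real k3) * (real k1 - real k2) * of_int (Gfun n k1 k2) / (r k3)^2
         = 0)"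
    if "admissible n J r \<and> card (r ` J) = 3 \<and> J = {k1, k2, k3} \<and> k1 < k2 \<and> k2 < k3" for J r k1 k2 k3
    using triple7[of k1 k2 k3 r] that unfolding fourth_coeff_def n_def by blast
qed

end
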